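(* Let $n\ge1$. The number of non-self-crossing lacings of a shoe with $n$ holes in each of its two columns equals $a_{n,n}$. The number of right lacings of such a shoe equals $((n-1)!)^2\,a_{n,n}$.
   Context: For nonnegative integers $p,q$, $a_{p,q}$ denotes the number of ways to partition a set consisting of $p$ marked points on a line and $q$ marked points on a parallel line into pairs, joining the two points of each pair by a straight segment, such that no two segments have a common point (in particular, no endpoint lies on another segment). A shoe has two vertical columns of holes. The left column has holes $L_1,\dots,L_n$ at points $(0,-1),\dots,(0,-n)$, and the right column has holes $R_1,\dots,R_n$ at $(1,-1),\dots,(1,-n)$, numbered from top to bottom. A lacing is a sequence of holes in which every hole occurs exactly once. It is considered without orientation and without topological details, i.e. as a Hamiltonian path in the complete graph on the $2n$ holes. It must also have the property that every hole other than the first and last one has at least one of its two neighbours along the lacing in the opposite column. A right lacing is such a lacing whose two ends are the topmost holes $L_1$ and $R_1$. A non-self-crossing lacing is such a lacing starting at $L_1$ and ending at $R_n$ whose drawing satisfies the following: when consecutive holes are joined by straight segments, the resulting polygonal line has no self-intersections. *)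

theory Defs
  imports "HOL-Analysis.Analysis" "HOL-Library.Disjoint_Sets"
begin

type_synonym point = "real \<times> real"

definition left_hole :: "nat \<Rightarrow> point" where
  "left_hole i = (0, - real i)"

definition right_hole :: "nat \<Rightarrow> point" where
  "right_hole i = (1, - real i)"

definition holes :: "nat \<Rightarrow> point set" where
  "holes n = left_hole ` {1..n} \<union> right_hole ` {1..n}"

definition noncrossing_pairings :: "point set \<Rightarrow> point set set set" where
  "noncrossing_pairings S =
    {P. partition_on S P \<and> (\<forall>e\<in>P. card e = 2) \<and>
        (\<forall>u v x y. {u, v} \<in> P \<longrightarrow> {x, y} \<in> P \<longrightarrow> {u, v} \<noteq> {x, y} \<longrightarrow>
           closed_segment u v \<inter> closed_segment x y = {})}"

(* Whether two such segments meet depends only on the order of the marked points on each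
   of the two lines, so the unit-spaced positions used here represent any placement. *)
definition a_count :: "nat \<Rightarrow> nat \<Rightarrow> nat" where
  "a_count p q = card (noncrossing_pairings (left_hole ` {1..p} \<union> right_hole ` {1..q}))"

(* The first coordinate of a hole identifies its column. *)
definition lacing_sequence :: "nat \<Rightarrow> point list \<Rightarrow> bool" where
  "lacing_sequence n xs \<longleftrightarrow>
     distinct xs \<and> set xs = holes n \<and>
     (\<forall>i. 0 < i \<and> i + 1 < length xs \<longrightarrow>
        fst (xs ! (i - 1)) \<noteq> fst (xs ! i) \<or> fst (xs ! (i + 1)) \<noteq> fst (xs ! i))"

(* A lacing has no orientation: it is a sequence up to reversal. *)
definition lacings :: "nat \<Rightarrow> point list set set" where
  "lacings n = (\<lambda>xs. {xs, rev xs}) ` {xs. lacing_sequence n xs}"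

definition right_lacings :: "nat \<Rightarrow> point list set set" where
  "right_lacings n =
     {l \<in> lacings n. \<exists>xs\<in>l. hd xs = left_hole 1 \<and> last xs = right_hole 1}"

(* Consecutive segments share their common vertex and nothing else;
   non-consecutive segments are disjoint. *)
definition no_self_intersection :: "point list \<Rightarrow> bool" where
  "no_self_intersection xs \<longleftrightarrow>
     (\<forall>i j. i < j \<and> j + 1 < length xs \<longrightarrow>
        closed_segment (xs ! i) (xs ! (i + 1)) \<inter> closed_segment (xs ! j) (xs ! (j + 1)) =
          (if j = i + 1 then {xs ! j} else {}))"

definition non_self_crossing_lacings :: "nat \<Rightarrow> point list set set" where
  "non_self_crossing_lacings n =
     {l \<in> lacings n. \<exists>xs\<in>l. hd xs = left_hole 1 \<and> last xs = right_hole n \<and>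
        no_self_intersection xs}"

end

(*
  A segment between two holes of one column must join neighbours, and the segments between the
  columns meet both columns in the same order. So a noncrossing pairing amounts to two sets of
  disjoint dominoes, one in each column and equally many, the remaining holes being matched in
  order from top to bottom.
  For n holes per column these are pairs of compositions of n into the same number of parts 1 and 2.

  Recording only the columns visited by a lacing gives a word without three equal consecutive
  letters; if it starts on the left and ends on the right, its run lengths are such a pair of
  compositions. A right lacing is a word together with arbitrary orders of the two columns in which
  only L_1 and R_1 are fixed. For a lacing from L_1 to R_n, each crossing segment separates what
  comes after it from what lies above it, so without self-intersections both columns are visited
  from top to bottom and the word determines the lacing.
*)
theory Submission
  imports Defs "HOL-Combinatorics.Multiset_Permutations"
begin

section \<open>Segments between two columns\<close>

text \<open>Both kinds of lacing give the same words, since each starts in the left column and ends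
  in the right one; ending in \<open>R_1\<close> or in \<open>R_n\<close> affects only the order
  inside the right column. A column of \<open>n\<close> holes with \<open>d\<close> dominoes has
  \<open>n - d\<close> parts, so equally many dominoes in two columns of length \<open>n\<close>
  mean equally many parts. Domino sets and compositions are therefore compared by counting them for
  each number of parts, through a common recurrence. The delicate point is the geometry. A segment
  disjoint from one that joins the columns has both ends on the same side of it, which leaves open
  on which side the rest of a lacing runs. The end \<open>R_n\<close>, being the lowest hole of its
  column, settles this, and the information travels backwards along the lacing. The condition on
  neighbours supplies a joining segment at every interior hole; the first hole is covered by
  \<open>L_1\<close> being topmost.\<close>

definition side :: "point \<Rightarrow> point \<Rightarrow> point \<Rightarrow> real" where
  "side u v w = snd w - snd u - (fst w - fst u) * (snd v - snd u) / (fst v - fst u)"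

lemma side_first: "fst w = fst u \<Longrightarrow> side u v w = snd w - snd u"
  by (simp add: side_def)

lemma side_second: "fst w = fst v \<Longrightarrow> fst u \<noteq> fst v \<Longrightarrow> side u v w = snd w - snd v"
  by (simp add: side_def)

text \<open>The vertical offset of a point from the line through \<open>u\<close> and
  \<open>v\<close> is an affine function of the point, so its sign along a segment is controlled by
  its values at the two ends. The geometric arguments below rest on this.\<close>

lemma side_affine: "side u v ((1 - t) *\<^sub>R x + t *\<^sub>R y) = (1 - t) * side u v x + t * side u v y"
  by (simp add: side_def field_simps add_divide_distrib diff_divide_distrib)

lemma side_closed_segment:
  assumes "z \<in> closed_segment u v" "fst u \<noteq> fst v"
  shows "side u v z = 0"
proof -
  obtain t where "z = (1 - t) *\<^sub>R u + t *\<^sub>R v"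
    using assms(1) by (auto simp: in_segment)
  then show ?thesis
    using assms(2) by (simp add: side_affine) (simp add: side_def)
qed

lemma closed_segment_sideI:
  assumes "fst u \<noteq> fst v" "fst z \<in> closed_segment (fst u) (fst v)" "side u v z = 0"
  shows "z \<in> closed_segment u v"
proof -
  obtain t where t: "0 \<le> t" "t \<le> 1" "fst z = (1 - t) * fst u + t * fst v"
    using assms(2) by (auto simp: in_segment)
  have "fst z - fst u = t * (fst v - fst u)"
    using t(3) by (simp add: algebra_simps)
  then have "snd z = snd u + t * (snd v - snd u)"
    using assms(1,3) by (simp add: side_def)
  then have "z = (1 - t) *\<^sub>R u + t *\<^sub>R v"
    using t(3) by (simp add: prod_eq_iff algebra_simps)
  then show ?thesis
    using t by (auto simp: in_segment)
qed

definition in_columns :: "point \<Rightarrow> bool" where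
  "in_columns p \<longleftrightarrow> fst p = 0 \<or> fst p = 1"

lemma fst_closed_segment:
  assumes "z \<in> closed_segment x y" "in_columns x" "in_columns y"
  shows "0 \<le> fst z" "fst z \<le> 1"
proof -
  obtain t where t: "0 \<le> t" "t \<le> 1" "fst z = (1 - t) * fst x + t * fst y"
    using assms(1) by (auto simp: in_segment)
  then show "0 \<le> fst z" "fst z \<le> 1"
    using assms(2,3) by (auto simp: in_columns_def)
qed

text \<open>If the offsets of \<open>x\<close> and \<open>y\<close> did not have the same strict
  sign, the offset would vanish somewhere on their segment. As \<open>u\<close> and \<open>v\<close>
  lie in different columns, their segment spans the whole strip, so that zero would be a common
  point.\<close>

lemma disjoint_segments_same_side:
  assumes "fst u \<noteq> fst v" "in_columns u" "in_columns v" "in_columns x" "in_columns y"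
    and disj: "closed_segment u v \<inter> closed_segment x y = {}"
  shows "side u v x * side u v y > 0"
proof (rule ccontr)
  let ?a = "side u v x" and ?b = "side u v y"
  assume neg: "\<not> ?a * ?b > 0"
  \<comment> \<open>The zero of the affine interpolation between \<open>?a\<close> and
    \<open>?b\<close> is at \<open>?a / (?a - ?b)\<close>.\<close>
  obtain t where t: "0 \<le> t" "t \<le> 1" "(1 - t) * ?a + t * ?b = 0"
  proof (cases "?a = 0")
    case True
    then show ?thesis by (intro that[of 0]) auto
  next
    case False
    then consider "?a > 0" "?b \<le> 0" | "?a < 0" "?b \<ge> 0"
      using neg False by (auto simp: zero_less_mult_iff not_less neq_iff)
    then show ?thesis
      by cases (rule that[of "?a / (?a - ?b)"]; simp add: field_simps)+
  qed
  define z where "z = (1 - t) *\<^sub>R x + t *\<^sub>R y"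
  have z: "z \<in> closed_segment x y"
    using t by (auto simp: z_def in_segment)
  have "closed_segment (fst u) (fst v) = {0..1}"
    using assms(1-3) by (auto simp: in_columns_def closed_segment_eq_real_ivl)
  then have "z \<in> closed_segment u v"
    using fst_closed_segment[OF z] assms t(3)
    by (intro closed_segment_sideI) (auto simp: z_def side_affine)
  then show False
    using z disj by auto
qed

text \<open>The second pair is the lower one. Heights are compared only within a column, so two
  vertical segments in different columns satisfy this vacuously.\<close>

definition below :: "point \<Rightarrow> point \<Rightarrow> point \<Rightarrow> point \<Rightarrow> bool" where
  "below u v x y \<longleftrightarrow> (\<forall>p\<in>{u, v}. \<forall>q\<in>{x, y}. fst p = fst q \<longrightarrow> snd q < snd p)"

lemma convex_combination_pos:
  fixes a b t :: real
  assumes "0 \<le> t" "t \<le> 1" "a > 0" "b > 0"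
  shows "(1 - t) * a + t * b > 0"
proof (cases "t = 0")
  case False
  then have "t * b > 0" "(1 - t) * a \<ge> 0"
    using assms by auto
  then show ?thesis by linarith
qed (use assms in auto)

text \<open>If one segment joins the columns, both ends of the other lie strictly on one side of it,
  hence so does the whole other segment. Two vertical segments with a common point share a column,
  and there heights separate them.\<close>

lemma below_disjoint:
  assumes "below u v x y" "in_columns u" "in_columns v" "in_columns x" "in_columns y"
  shows "closed_segment u v \<inter> closed_segment x y = {}"
proof (rule ccontr)
  assume "closed_segment u v \<inter> closed_segment x y \<noteq> {}"
  then obtain z where z: "z \<in> closed_segment u v" "z \<in> closed_segment x y"
    by auto
  obtain s where s: "0 \<le> s" "s \<le> 1" "z = (1 - s) *\<^sub>R u + s *\<^sub>R v"
    using z(1) by (auto simp: in_segment)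
  obtain t where t: "0 \<le> t" "t \<le> 1" "z = (1 - t) *\<^sub>R x + t *\<^sub>R y"
    using z(2) by (auto simp: in_segment)
  consider "fst u \<noteq> fst v" | "fst x \<noteq> fst y" | "fst u = fst v" "fst x = fst y"
    by blast
  then show False
  proof cases
    case 1
    have "- side u v p > 0" if "p \<in> {x, y}" for p
    proof -
      have "fst p = fst u \<or> fst p = fst v"
        using 1 assms(2-) that by (auto simp: in_columns_def)
      moreover have "snd p < snd w" if "w \<in> {u, v}" "fst w = fst p" for w
        using assms(1) that \<open>p \<in> {x, y}\<close> unfolding below_def by blast
      ultimately show ?thesis
        using 1 by (metis side_first side_second insertCI diff_less_0_iff_less neg_0_less_iff_less)
    qed
    then have "(1 - t) * (- side u v x) + t * (- side u v y) > 0"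
      using t by (intro convex_combination_pos) auto
    then show False
      using side_closed_segment[OF z(1) 1] t(3) by (simp add: side_affine)
  next
    case 2
    have "side x y p > 0" if "p \<in> {u, v}" for p
    proof -
      have "fst p = fst x \<or> fst p = fst y"
        using 2 assms(2-) that by (auto simp: in_columns_def)
      moreover have "snd w < snd p" if "w \<in> {x, y}" "fst p = fst w" for w
        using assms(1) that \<open>p \<in> {u, v}\<close> unfolding below_def by blast
      ultimately show ?thesis
        using 2 by (metis side_first side_second insertCI diff_gt_0_iff_gt)
    qed
    then have "(1 - s) * side x y u + s * side x y v > 0"
      using s by (intro convex_combination_pos) auto
    then show False
      using side_closed_segment[OF z(2) 2] s(3) by (simp add: side_affine)
  next
    case 3
    have "fst z = fst u" "fst z = fst x"
      by (simp add: s(3) 3 algebra_simps, simp add: t(3) 3 algebra_simps)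
    with 3 have eq: "fst u = fst x" "fst u = fst y" "fst v = fst x" "fst v = fst y"
      by auto
    define m where "m = max (snd x) (snd y)"
    have "snd u - m > 0" "snd v - m > 0"
      using assms(1) eq by (auto simp: below_def m_def)
    from convex_combination_pos[OF s(1,2) this] have "snd z > m"
      by (simp add: s(3) algebra_simps)
    moreover have "(1 - t) * snd x + t * snd y \<le> (1 - t) * m + t * m"
      using t by (intro add_mono mult_left_mono) (auto simp: m_def)
    ultimately show False
      by (simp add: t(3) algebra_simps)
  qed
qed

text \<open>Comparing the column coordinates of a common point leaves only \<open>v\<close>, unless
  \<open>u\<close> and \<open>w\<close> share a column. In that case the parameters satisfy
  \<open>1 - s = t\<close>, and the different heights of \<open>u\<close> and \<open>w\<close> force
  \<open>t = 0\<close>.\<close>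

lemma adjacent_segments_meet:
  assumes "in_columns u" "in_columns v" "in_columns w" "u \<noteq> v" "v \<noteq> w" "u \<noteq> w"
    and "\<not> (fst u = fst v \<and> fst v = fst w)"
  shows "closed_segment u v \<inter> closed_segment v w = {v}"
proof -
  have "z = v" if z: "z \<in> closed_segment u v" "z \<in> closed_segment v w" for z
  proof -
    obtain s where s: "z = (1 - s) *\<^sub>R u + s *\<^sub>R v"
      using z(1) by (auto simp: in_segment)
    obtain t where t: "z = (1 - t) *\<^sub>R v + t *\<^sub>R w"
      using z(2) by (auto simp: in_segment)
    have 1: "(1 - s) * fst u + s * fst v = (1 - t) * fst v + t * fst w"
      and 2: "(1 - s) * snd u + s * snd v = (1 - t) * snd v + t * snd w"
      using s t by (metis fst_add fst_scaleR real_scaleR_def, metis snd_add snd_scaleR real_scaleR_def)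
    consider "fst u = fst v" "fst w \<noteq> fst v" | "fst w = fst v" "fst u \<noteq> fst v"
      | "fst u = fst w" "fst u \<noteq> fst v"
      using assms by (auto simp: in_columns_def)
    then show ?thesis
    proof cases
      case 1
      with \<open>(1 - s) * fst u + s * fst v = (1 - t) * fst v + t * fst w\<close>
      have "t * (fst w - fst v) = 0" by (simp add: algebra_simps)
      then show ?thesis using 1 t by simp
    next
      case 2
      with 1 have "(1 - s) * (fst u - fst v) = 0" by (simp add: algebra_simps)
      then show ?thesis using 2 s by simp
    next
      case 3
      with 1 have "(1 - s - t) * (fst u - fst v) = 0" by (simp add: algebra_simps)
      then have "1 - s = t" using 3 by simp
      then have "t * (snd u - snd w) = 0" using 2 by (simp add: algebra_simps flip: \<open>1 - s = t\<close>)
      moreover have "snd u \<noteq> snd w" using 3 assms(6) by (simp add: prod_eq_iff)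
      ultimately show ?thesis using t by simp
    qed
  qed
  then show ?thesis by auto
qed

section \<open>Compositions and sets of dominoes\<close>

definition tilings :: "nat \<Rightarrow> nat list set" where
  "tilings n = {cs. set cs \<subseteq> {1, 2} \<and> sum_list cs = n}"

lemma length_le_sum_list: "set cs \<subseteq> {1, 2} \<Longrightarrow> length cs \<le> sum_list cs" for cs :: "nat list"
  by (induction cs) auto

lemma length_tiling_le: "cs \<in> tilings n \<Longrightarrow> length cs \<le> n"
  using length_le_sum_list by (auto simp: tilings_def)

lemma finite_tilings: "finite (tilings n)"
proof (rule finite_subset)
  show "tilings n \<subseteq> {cs. set cs \<subseteq> {1, 2} \<and> length cs \<le> n}"
    using length_le_sum_list by (auto simp: tilings_def)
qed (rule finite_lists_length_le, simp)

lemma Nil_in_tilings: "[] \<in> tilings n \<longleftrightarrow> n = 0"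
  by (auto simp: tilings_def)

lemma Cons_in_tilings:
  "c # cs \<in> tilings n \<longleftrightarrow> c \<in> {1, 2} \<and> c \<le> n \<and> cs \<in> tilings (n - c)"
  by (auto simp: tilings_def)

text \<open>A set of disjoint dominoes in a column of \<open>n\<close> holes, each domino recorded
  by its upper hole: \<open>i\<close> stands for the pair of \<open>i\<close> and
  \<open>Suc i\<close>.\<close>

definition sparse :: "nat \<Rightarrow> nat set set" where
  "sparse n = {A. A \<subseteq> {1..<n} \<and> (\<forall>i\<in>A. Suc i \<notin> A)}"

lemma finite_sparse: "finite (sparse n)"
  by (rule finite_subset[of _ "Pow {1..<n}"]) (auto simp: sparse_def)

lemma finite_mem_sparse: "A \<in> sparse n \<Longrightarrow> finite A"
  by (auto simp: sparse_def intro: finite_subset)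

lemma card_mem_sparse_le: "A \<in> sparse n \<Longrightarrow> card A \<le> n - 1"
  using card_mono[of "{1..<n}" A] by (auto simp: sparse_def)

text \<open>Split by whether the first part is 1 or 2.\<close>

lemma card_tilings_Suc_Suc:
  "card {cs \<in> tilings (Suc (Suc n)). length cs = Suc k} =
   card {cs \<in> tilings (Suc n). length cs = k} + card {cs \<in> tilings n. length cs = k}"
proof -
  have "{cs \<in> tilings (Suc (Suc n)). length cs = Suc k} =
      Cons 1 ` {cs \<in> tilings (Suc n). length cs = k} \<union> Cons 2 ` {cs \<in> tilings n. length cs = k}"
    (is "?L = ?R")
  proof (intro equalityI subsetI)
    fix cs assume "cs \<in> ?L"
    then show "cs \<in> ?R"
      by (cases cs) (auto simp: Cons_in_tilings)
  qed (auto simp: Cons_in_tilings)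
  then show ?thesis
    by (simp only:) (subst card_Un_disjoint; auto simp: finite_tilings card_image)
qed

text \<open>Split by whether the lowest hole is covered, that is, whether \<open>Suc n\<close> is an
  upper hole. Writing the cardinality as \<open>card A + k\<close> makes \<open>k\<close> the number
  of parts, dominoes and single holes together, so the recurrence is that of
  \<open>card_tilings_Suc_Suc\<close>.\<close>

lemma card_sparse_Suc_Suc:
  "card {A \<in> sparse (Suc (Suc n)). card A + Suc k = Suc (Suc n)} =
   card {A \<in> sparse (Suc n). card A + k = Suc n} + card {A \<in> sparse n. card A + k = n}"
proof -
  have notin: "Suc n \<notin> A" if "A \<in> sparse n" for A
    using that by (auto simp: sparse_def)
  have "{A \<in> sparse (Suc (Suc n)). card A + Suc k = Suc (Suc n)} =
      {A \<in> sparse (Suc n). card A + k = Suc n} \<union>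
      insert (Suc n) ` {A \<in> sparse n. card A + k = n}" (is "?L = ?R1 \<union> ?R2")
  proof (intro equalityI subsetI)
    fix A assume A: "A \<in> ?L"
    show "A \<in> ?R1 \<union> ?R2"
    proof (cases "Suc n \<in> A")
      case False
      then have "A \<subseteq> {1..<Suc n}"
        using A unfolding sparse_def by (auto simp: less_Suc_eq)
      then show ?thesis using A by (auto simp: sparse_def)
    next
      case True
      have lt: "x < n" if "x \<in> A" "x \<noteq> Suc n" for x
      proof -
        have "x < Suc (Suc n)" "x \<noteq> n"
          using A True that unfolding sparse_def by auto
        then show ?thesis using that by auto
      qed
      have "A - {Suc n} \<subseteq> {1..<n}"
      proof
        fix x assume "x \<in> A - {Suc n}"
        then show "x \<in> {1..<n}"
          using lt[of x] A by (auto simp: sparse_def)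
      qed
      then have "A - {Suc n} \<in> sparse n"
        using A by (simp add: sparse_def)
      moreover have "card A = Suc (card (A - {Suc n}))"
        using True A card.remove[of A "Suc n"] finite_mem_sparse by blast
      ultimately have "A - {Suc n} \<in> {A \<in> sparse n. card A + k = n}"
        using A by auto
      moreover have "A = insert (Suc n) (A - {Suc n})"
        using True by auto
      ultimately show ?thesis by blast
    qed
  next
    fix A assume "A \<in> ?R1 \<union> ?R2"
    then consider "A \<in> ?R1" | B where "A = insert (Suc n) B" "B \<in> sparse n" "card B + k = n"
      by blast
    then show "A \<in> ?L"
    proof cases
      case 1
      then show ?thesis by (auto simp: sparse_def)
    next
      case 2
      have "card A = Suc (card B)"
        using 2 notin[of B] finite_mem_sparse[of B n] by simp
      moreover have "A \<subseteq> {1..<Suc (Suc n)}"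
        using 2 by (auto simp: sparse_def)
      moreover have "Suc i \<notin> A" if "i \<in> A" for i
        using 2 that by (auto simp: sparse_def)
      ultimately show ?thesis using 2(3) by (simp add: sparse_def)
    qed
  qed
  moreover have "?R1 \<inter> ?R2 = {}"
    by (auto simp: sparse_def)
  moreover have "inj_on (insert (Suc n)) {A \<in> sparse n. card A + k = n}"
    using notin by (auto simp: inj_on_def dest: insert_ident)
  ultimately show ?thesis
    by (simp add: card_Un_disjoint finite_sparse card_image)
qed

lemma tilings_le_1: "n \<le> 1 \<Longrightarrow> tilings n = {replicate n 1}"
proof (intro equalityI subsetI)
  fix cs assume "n \<le> 1" "cs \<in> tilings n"
  then show "cs \<in> {replicate n 1}"
    by (cases cs; cases "tl cs"; cases n) (auto simp: tilings_def)
qed (auto simp: tilings_def le_Suc_eq)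

text \<open>Both sides satisfy the same recurrence in \<open>n\<close> and \<open>k\<close>. Its
  boundary consists of \<open>n \<le> 1\<close> and of \<open>k = 0\<close> with
  \<open>n \<ge> 2\<close>, where both sides are 0.\<close>

lemma card_sparse_eq_card_tilings:
  "card {A \<in> sparse n. card A + k = n} = card {cs \<in> tilings n. length cs = k}"
proof (induction n arbitrary: k rule: less_induct)
  case (less n)
  consider "n \<le> 1" | m where "n = Suc (Suc m)" "k = 0" | m l where "n = Suc (Suc m)" "k = Suc l"
    by (metis One_nat_def Suc_leI not0_implies_Suc not_le zero_le less_Suc0 le_SucI not_less_eq_eq)
  then show ?case
  proof cases
    case 1
    then have sparse: "sparse n = {{}}" by (auto simp: sparse_def)
    have tilings: "tilings n = {replicate n 1}"
      using 1 tilings_le_1 by blast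
    have "{A \<in> sparse n. card A + k = n} = (if k = n then {{}} else {})"
      unfolding sparse by auto
    moreover have "{cs \<in> tilings n. length cs = k} = (if k = n then {replicate n 1} else {})"
      unfolding tilings by auto
    ultimately show ?thesis by simp
  next
    case (2 m)
    have "{A \<in> sparse n. card A + k = n} = {}"
      using card_mem_sparse_le[of _ n] 2 by fastforce
    moreover have "{cs \<in> tilings n. length cs = k} = {}"
      using 2 by (auto simp: Nil_in_tilings)
    ultimately show ?thesis by (simp only: card.empty)
  next
    case (3 m l)
    then show ?thesis
      using less[of m l] less[of "Suc m" l] by (simp only: card_sparse_Suc_Suc card_tilings_Suc_Suc)
  qed
qed

text \<open>Rewrites a count of pairs with matching keys as a sum of products, so that each factor
  can be replaced separately.\<close>

lemma card_same_key:
  fixes f g :: "_ \<Rightarrow> nat"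
  assumes "finite X" "finite Y" "\<And>x. x \<in> X \<Longrightarrow> f x \<le> n"
  shows "card {(x, y). x \<in> X \<and> y \<in> Y \<and> f x = g y} =
    (\<Sum>k\<le>n. card {x \<in> X. f x = k} * card {y \<in> Y. g y = k})"
proof -
  have "{(x, y). x \<in> X \<and> y \<in> Y \<and> f x = g y} =
      (\<Union>k\<le>n. {x \<in> X. f x = k} \<times> {y \<in> Y. g y = k})"
    using assms(3) by fastforce
  also have "card \<dots> = (\<Sum>k\<le>n. card ({x \<in> X. f x = k} \<times> {y \<in> Y. g y = k}))"
    using assms(1,2) by (intro card_UN_disjoint) auto
  finally show ?thesis by (simp add: card_cartesian_product)
qed

lemma card_sparse_pairs:
  "card {(A, B). A \<in> sparse n \<and> B \<in> sparse n \<and> card A = card B} =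
   card {(cs, ds). cs \<in> tilings n \<and> ds \<in> tilings n \<and> length cs = length ds}"
proof -
  have le: "card A \<le> n" if "A \<in> sparse n" for A
    using card_mem_sparse_le[OF that] by auto
  have eq: "n - card A = n - card B \<longleftrightarrow> card A = card B" if "A \<in> sparse n" "B \<in> sparse n" for A B
    using le[OF that(1)] le[OF that(2)] by linarith
  \<comment> \<open>The key changes from the number of dominoes to the number of parts
    \<open>n - card A\<close>; no information is lost because \<open>card A \<le> n\<close>.\<close>
  have "{(A, B). A \<in> sparse n \<and> B \<in> sparse n \<and> card A = card B} =
      {(A, B). A \<in> sparse n \<and> B \<in> sparse n \<and> n - card A = n - card B}"
    using eq by blast
  also have "card \<dots> = (\<Sum>k\<le>n. card {A \<in> sparse n. n - card A = k} * card {A \<in> sparse n. n - card A = k})"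
    by (rule card_same_key) (auto simp: finite_sparse)
  also have "\<dots> = (\<Sum>k\<le>n. card {cs \<in> tilings n. length cs = k} * card {cs \<in> tilings n. length cs = k})"
  proof (rule sum.cong)
    fix k assume "k \<in> {..n}"
    then have "{A \<in> sparse n. n - card A = k} = {A \<in> sparse n. card A + k = n}"
      using le by auto
    then show "card {A \<in> sparse n. n - card A = k} * card {A \<in> sparse n. n - card A = k} =
      card {cs \<in> tilings n. length cs = k} * card {cs \<in> tilings n. length cs = k}"
      by (simp add: card_sparse_eq_card_tilings)
  qed simp
  also have "\<dots> = card {(cs, ds). cs \<in> tilings n \<and> ds \<in> tilings n \<and> length cs = length ds}"
    by (rule card_same_key[symmetric]) (auto simp: finite_tilings length_tiling_le)
  finally show ?thesis .
qed

section \<open>Noncrossing pairings\<close>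

lemma in_columns_hole [simp]: "in_columns (left_hole i)" "in_columns (right_hole i)"
  by (auto simp: in_columns_def left_hole_def right_hole_def)

lemma hole_coordinates [simp]:
  "fst (left_hole i) = 0" "snd (left_hole i) = - real i"
  "fst (right_hole i) = 1" "snd (right_hole i) = - real i"
  by (auto simp: left_hole_def right_hole_def)

lemma hole_eq_iff [simp]:
  "left_hole i = left_hole j \<longleftrightarrow> i = j" "right_hole i = right_hole j \<longleftrightarrow> i = j"
  "left_hole i \<noteq> right_hole j" "right_hole j \<noteq> left_hole i"
  by (auto simp: left_hole_def right_hole_def)

text \<open>Expresses "the k-th uncovered hole of one column goes to the k-th uncovered hole of the
  other" without choosing enumerations.\<close>

definition rank :: "nat set \<Rightarrow> nat \<Rightarrow> nat" where
  "rank U i = card {j \<in> U. j < i}"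

lemma rank_less:
  assumes "finite U" "i \<in> U" "i < k"
  shows "rank U i < rank U k"
  unfolding rank_def using assms by (intro psubset_card_mono) auto

lemma rank_inject:
  assumes "finite U" "i \<in> U" "k \<in> U" "rank U i = rank U k"
  shows "i = k"
  using rank_less[OF assms(1,2), of k] rank_less[OF assms(1,3), of i] assms(4)
  by (cases i k rule: linorder_cases) auto

lemma rank_image:
  assumes "finite U"
  shows "rank U ` U = {..<card U}"
proof (rule card_subset_eq)
  show "rank U ` U \<subseteq> {..<card U}"
    using assms by (auto simp: rank_def intro!: psubset_card_mono)
  show "card (rank U ` U) = card {..<card U}"
    using assms by (simp add: card_image inj_onI rank_inject)
qed simp

definition free :: "nat \<Rightarrow> nat set \<Rightarrow> nat set" where
  "free p A = {1..p} - A - Suc ` A"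

lemma finite_free [simp]: "finite (free p A)"
  by (simp add: free_def)

lemma card_free:
  assumes "A \<in> sparse p"
  shows "card (free p A) + 2 * card A = p"
proof -
  have "A \<inter> Suc ` A = {}" "A \<subseteq> {1..p}" "Suc ` A \<subseteq> {1..p}"
    using assms by (auto simp: sparse_def)
  then have "card ({1..p} - (A \<union> Suc ` A)) = p - card (A \<union> Suc ` A)" "card (A \<union> Suc ` A) \<le> p"
    "card (A \<union> Suc ` A) = card A + card (Suc ` A)"
    using finite_mem_sparse[OF assms] card_mono[of "{1..p}" "A \<union> Suc ` A"]
    by (auto simp: card_Diff_subset card_Un_disjoint)
  moreover have "free p A = {1..p} - (A \<union> Suc ` A)"
    by (auto simp: free_def)
  ultimately show ?thesis
    by (simp add: card_image)
qed

abbreviation marked :: "nat \<Rightarrow> nat \<Rightarrow> point set" where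
  "marked p q \<equiv> left_hole ` {1..p} \<union> right_hole ` {1..q}"

text \<open>By \<open>noncrossing_pairing_decompose\<close> a noncrossing pairing of
  \<open>marked p q\<close> with vertical pairs \<open>A\<close> and \<open>B\<close> can only be
  this one.\<close>

definition pairing :: "nat \<Rightarrow> nat \<Rightarrow> nat set \<Rightarrow> nat set \<Rightarrow> point set set" where
  "pairing p q A B =
     (\<lambda>i. {left_hole i, left_hole (Suc i)}) ` A \<union>
     (\<lambda>j. {right_hole j, right_hole (Suc j)}) ` B \<union>
     {{left_hole i, right_hole j} | i j.
        i \<in> free p A \<and> j \<in> free q B \<and> rank (free p A) i = rank (free q B) j}"

lemma pairing_cases:
  assumes "e \<in> pairing p q A B"
  obtains (left) i where "i \<in> A" "e = {left_hole i, left_hole (Suc i)}"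
  | (right) j where "j \<in> B" "e = {right_hole j, right_hole (Suc j)}"
  | (cross) i j where "i \<in> free p A" "j \<in> free q B" "rank (free p A) i = rank (free q B) j"
      "e = {left_hole i, right_hole j}"
  using assms unfolding pairing_def by blast

lemma Union_pairing:
  assumes "A \<in> sparse p" "B \<in> sparse q" "card (free p A) = card (free q B)"
  shows "\<Union>(pairing p q A B) = marked p q"
proof (intro equalityI subsetI)
  fix x assume "x \<in> \<Union>(pairing p q A B)"
  then obtain e where e: "e \<in> pairing p q A B" "x \<in> e" by blast
  from e(1) show "x \<in> marked p q"
  proof (cases rule: pairing_cases)
    case (left i)
    then have "i \<in> {1..p}" "Suc i \<in> {1..p}"
      using assms(1) by (auto simp: sparse_def)
    then show ?thesis using left e(2) by blast
  next
    case (right j)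
    then have "j \<in> {1..q}" "Suc j \<in> {1..q}"
      using assms(2) by (auto simp: sparse_def)
    then show ?thesis using right e(2) by blast
  next
    case (cross i j)
    then show ?thesis using e(2) by (auto simp: free_def)
  qed
next
  fix x assume "x \<in> marked p q"
  then consider i where "x = left_hole i" "i \<in> {1..p}" | j where "x = right_hole j" "j \<in> {1..q}"
    by blast
  then show "x \<in> \<Union>(pairing p q A B)"
  proof cases
    case (1 i)
    consider "i \<in> A" | k where "k \<in> A" "i = Suc k" | "i \<in> free p A"
      using 1 by (auto simp: free_def)
    then show ?thesis
    proof cases
      case 3
      then have "rank (free p A) i \<in> rank (free q B) ` free q B"
        using rank_image[of "free p A"] rank_image[of "free q B"] assms(3) by auto
      then show ?thesis using 1 3 unfolding pairing_def by blast
    qed (use 1 in \<open>auto simp: pairing_def\<close>)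
  next
    case (2 j)
    consider "j \<in> B" | k where "k \<in> B" "j = Suc k" | "j \<in> free q B"
      using 2 by (auto simp: free_def)
    then show ?thesis
    proof cases
      case 3
      then have "rank (free q B) j \<in> rank (free p A) ` free p A"
        using rank_image[of "free p A"] rank_image[of "free q B"] assms(3) by auto
      then obtain i where "i \<in> free p A" "rank (free p A) i = rank (free q B) j" by force
      then show ?thesis using 2 3 unfolding pairing_def by blast
    qed (use 2 in \<open>auto simp: pairing_def\<close>)
  qed
qed

text \<open>Edges are unordered while segments have ordered ends; quantifying over all
  representations gives a symmetric relation on edges.\<close>

definition separated :: "point set \<Rightarrow> point set \<Rightarrow> bool" where
  "separated e e' \<longleftrightarrow>
     (\<forall>u v x y. e = {u, v} \<longrightarrow> e' = {x, y} \<longrightarrow> closed_segment u v \<inter> closed_segment x y = {})"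

lemma separated_commute: "separated e e' \<longleftrightarrow> separated e' e"
  unfolding separated_def by blast

lemma below_separated:
  assumes "below u v x y" "in_columns u" "in_columns v" "in_columns x" "in_columns y"
  shows "separated {u, v} {x, y}"
  unfolding separated_def
proof (intro allI impI)
  fix u' v' x' y' assume "{u, v} = {u', v'}" "{x, y} = {x', y'}"
  then show "closed_segment u' v' \<inter> closed_segment x' y' = {}"
    using below_disjoint[OF assms] by (auto simp: doubleton_eq_iff closed_segment_commute)
qed

text \<open>Any two distinct edges, taken in a suitable order, satisfy \<open>below\<close>.
  Dominoes cover no free hole and do not overlap, and for two edges between the columns equality of
  ranks makes the order on the left agree with the order on the right.\<close>

lemma separated_pairing:
  assumes "A \<in> sparse p" "B \<in> sparse q" "e \<in> pairing p q A B" "e' \<in> pairing p q A B" "e \<noteq> e'"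
  shows "separated e e'"
proof -
  have LL: "separated {left_hole i, left_hole (Suc i)} {left_hole k, left_hole (Suc k)}"
    if "i \<in> A" "k \<in> A" "i < k" for i k
  proof -
    have "Suc i \<noteq> k" using that assms(1) by (auto simp: sparse_def)
    then show ?thesis
      using that by (intro below_separated) (auto simp: below_def)
  qed
  have RR: "separated {right_hole i, right_hole (Suc i)} {right_hole k, right_hole (Suc k)}"
    if "i \<in> B" "k \<in> B" "i < k" for i k
  proof -
    have "Suc i \<noteq> k" using that assms(2) by (auto simp: sparse_def)
    then show ?thesis
      using that by (intro below_separated) (auto simp: below_def)
  qed
  have LR: "separated {left_hole i, left_hole (Suc i)} {right_hole k, right_hole (Suc k)}" for i k
    by (intro below_separated) (auto simp: below_def)
  have LC: "separated {left_hole i, left_hole (Suc i)} {left_hole k, right_hole l}"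
    if "i \<in> A" "k \<in> free p A" for i k l
  proof -
    have "k \<noteq> i" "k \<noteq> Suc i" using that by (auto simp: free_def)
    then have "k < i \<or> Suc i < k" by linarith
    then show ?thesis
    proof
      assume "k < i"
      then show ?thesis
        by (subst separated_commute, intro below_separated) (auto simp: below_def)
    qed (intro below_separated, auto simp: below_def)
  qed
  have RC: "separated {right_hole j, right_hole (Suc j)} {left_hole k, right_hole l}"
    if "j \<in> B" "l \<in> free q B" for j k l
  proof -
    have "l \<noteq> j" "l \<noteq> Suc j" using that by (auto simp: free_def)
    then have "l < j \<or> Suc j < l" by linarith
    then show ?thesis
    proof
      assume "l < j"
      then show ?thesis
        by (subst separated_commute, intro below_separated) (auto simp: below_def)
    qed (intro below_separated, auto simp: below_def)
  qed
  have CC: "separated {left_hole i, right_hole j} {left_hole k, right_hole l}"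
    if "i \<in> free p A" "k \<in> free p A" "j \<in> free q B" "l \<in> free q B"
      "rank (free p A) i = rank (free q B) j" "rank (free p A) k = rank (free q B) l" "i < k" for i j k l
  proof -
    have "rank (free q B) j < rank (free q B) l"
      using rank_less[of "free p A" i k] that by simp
    then have "j < l"
      using rank_less[of "free q B" l j] that by (cases j l rule: linorder_cases) auto
    then show ?thesis
      using that by (intro below_separated) (auto simp: below_def)
  qed
  show ?thesis
    using assms(3)
  proof (cases rule: pairing_cases)
    case e: (left i)
    from assms(4) show ?thesis
    proof (cases rule: pairing_cases)
      case (left k)
      then show ?thesis
        using e LL[of i k] LL[of k i] assms(5) separated_commute[of e e']
        by (cases i k rule: linorder_cases) auto
    qed (use e LR LC in auto)
  next
    case e: (right j)
    from assms(4) show ?thesis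
    proof (cases rule: pairing_cases)
      case (left k)
      then show ?thesis using e LR separated_commute[of e e'] by simp
    next
      case (right k)
      then show ?thesis
        using e RR[of j k] RR[of k j] assms(5) separated_commute[of e e']
        by (cases j k rule: linorder_cases) auto
    qed (use e RC in auto)
  next
    case e: (cross i j)
    from assms(4) show ?thesis
    proof (cases rule: pairing_cases)
      case (left k)
      then show ?thesis using e LC separated_commute[of e e'] by simp
    next
      case (right k)
      then show ?thesis using e RC separated_commute[of e e'] by simp
    next
      case (cross k l)
      have "i = k \<Longrightarrow> j = l"
        using e cross rank_inject[of "free q B" j l] by simp
      then show ?thesis
        using e cross CC[of i k j l] CC[of k i l j] assms(5) separated_commute[of e e']
        by (cases i k rule: linorder_cases) auto
    qed
  qed
qed

text \<open>Disjointness of the blocks is implied by disjointness of the segments, which contain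
  their endpoints; of the partition property only the union remains.\<close>

lemma noncrossing_pairings_iff:
  "P \<in> noncrossing_pairings S \<longleftrightarrow>
    \<Union>P = S \<and> (\<forall>e\<in>P. card e = 2) \<and> (\<forall>e\<in>P. \<forall>e'\<in>P. e \<noteq> e' \<longrightarrow> separated e e')"
proof
  assume P: "P \<in> noncrossing_pairings S"
  then have "\<forall>u v x y. {u, v} \<in> P \<longrightarrow> {x, y} \<in> P \<longrightarrow> {u, v} \<noteq> {x, y} \<longrightarrow>
      closed_segment u v \<inter> closed_segment x y = {}"
    unfolding noncrossing_pairings_def mem_Collect_eq by (elim conjE)
  then have "separated e e'" if "e \<in> P" "e' \<in> P" "e \<noteq> e'" for e e'
    unfolding separated_def using that by metis
  then show "\<Union>P = S \<and> (\<forall>e\<in>P. card e = 2) \<and> (\<forall>e\<in>P. \<forall>e'\<in>P. e \<noteq> e' \<longrightarrow> separated e e')"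
    using P by (simp add: noncrossing_pairings_def partition_on_def)
next
  assume P: "\<Union>P = S \<and> (\<forall>e\<in>P. card e = 2) \<and> (\<forall>e\<in>P. \<forall>e'\<in>P. e \<noteq> e' \<longrightarrow> separated e e')"
  have "e \<inter> e' = {}" if e: "e \<in> P" "e' \<in> P" "e \<noteq> e'" for e e'
  proof -
    have "card e = 2" "card e' = 2" using P e by blast+
    then obtain u v x y where "e = {u, v}" "e' = {x, y}"
      by (auto simp: card_2_iff)
    moreover have "separated e e'"
      using P e by blast
    ultimately have "e = {u, v}" "e' = {x, y}" "closed_segment u v \<inter> closed_segment x y = {}"
      unfolding separated_def by blast+
    then show ?thesis
      using ends_in_segment[of u v] ends_in_segment[of x y] by blast
  qed
  moreover have "{} \<notin> P" using P by force
  ultimately have "partition_on S P"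
    using P by (simp add: partition_on_def disjoint_def)
  moreover have "closed_segment u v \<inter> closed_segment x y = {}"
    if "{u, v} \<in> P" "{x, y} \<in> P" "{u, v} \<noteq> {x, y}" for u v x y
  proof -
    have "separated {u, v} {x, y}" using conjunct2[OF conjunct2[OF P]] that by simp
    then show ?thesis unfolding separated_def by blast
  qed
  ultimately show "P \<in> noncrossing_pairings S"
    unfolding noncrossing_pairings_def using P by simp
qed

lemma pairing_noncrossing:
  assumes "A \<in> sparse p" "B \<in> sparse q" "card (free p A) = card (free q B)"
  shows "pairing p q A B \<in> noncrossing_pairings (marked p q)"
  unfolding noncrossing_pairings_iff
proof (intro conjI ballI impI)
  fix e assume "e \<in> pairing p q A B"
  then show "card e = 2"
    by (cases rule: pairing_cases) auto
qed (use Union_pairing[OF assms] separated_pairing[OF assms(1,2)] in auto)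

section \<open>Recovering the domino sets from a noncrossing pairing\<close>

definition left_pairs :: "point set set \<Rightarrow> nat set" where
  "left_pairs P = {i. {left_hole i, left_hole (Suc i)} \<in> P}"

definition right_pairs :: "point set set \<Rightarrow> nat set" where
  "right_pairs P = {j. {right_hole j, right_hole (Suc j)} \<in> P}"

lemma left_pairs_pairing: "left_pairs (pairing p q A B) = A"
  by (auto simp: left_pairs_def pairing_def doubleton_eq_iff)

lemma right_pairs_pairing: "right_pairs (pairing p q A B) = B"
  by (auto simp: right_pairs_def pairing_def doubleton_eq_iff)

lemma between_holes:
  "i < m \<Longrightarrow> m < j \<Longrightarrow> left_hole m \<in> closed_segment (left_hole i) (left_hole j)"
  "i < m \<Longrightarrow> m < j \<Longrightarrow> right_hole m \<in> closed_segment (right_hole i) (right_hole j)"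
  by (auto simp: in_segment prod_eq_iff field_simps
      intro!: exI[of _ "(real m - real i) / (real j - real i)"])

text \<open>A vertical pair that skipped a hole would pass through an endpoint of another edge, so
  vertical pairs are dominoes. The other edges match the free holes of the columns monotonically,
  and a monotone bijection preserves ranks.\<close>

lemma noncrossing_pairing_decompose:
  assumes P: "P \<in> noncrossing_pairings (marked p q)"
  defines "A \<equiv> left_pairs P" and "B \<equiv> right_pairs P"
  shows "A \<in> sparse p" "B \<in> sparse q" "card (free p A) = card (free q B)" "P = pairing p q A B"
proof -
  have un: "\<Union>P = marked p q" and two: "\<And>e. e \<in> P \<Longrightarrow> card e = 2"
    and sep: "\<And>e e'. e \<in> P \<Longrightarrow> e' \<in> P \<Longrightarrow> e \<noteq> e' \<Longrightarrow> separated e e'"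
    using P by (auto simp: noncrossing_pairings_iff)
  have same: "e = e'" if "e \<in> P" "e' \<in> P" "x \<in> e" "x \<in> e'" for e e' x
    using P that unfolding noncrossing_pairings_def partition_on_def disjoint_def by blast
  have disj: "{u, v} = {x, y}"
    if "{u, v} \<in> P" "{x, y} \<in> P" "z \<in> closed_segment u v" "z \<in> closed_segment x y" for u v x y z
    using sep[OF that(1,2)] that(3,4) unfolding separated_def by blast
  have hole_range: "left_hole i \<in> \<Union>P \<longleftrightarrow> i \<in> {1..p}" "right_hole i \<in> \<Union>P \<longleftrightarrow> i \<in> {1..q}" for i
    unfolding un by auto
  have pair: "\<exists>v. e = {x, v} \<and> x \<noteq> v \<and> v \<in> marked p q" if "e \<in> P" "x \<in> e" for e x
  proof -
    obtain a b where "e = {a, b}" "a \<noteq> b" using two[OF \<open>e \<in> P\<close>] by (auto simp: card_2_iff)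
    moreover from this have "a \<in> marked p q" "b \<in> marked p q"
      unfolding un[symmetric] using that(1) by blast+
    moreover have "x = a \<or> x = b"
      using \<open>e = {a, b}\<close> that(2) by simp
    ultimately show ?thesis
      by (metis insert_commute)
  qed
  have adjacent_left: "j = Suc i" if "{left_hole i, left_hole j} \<in> P" "i < j" for i j
  proof (rule ccontr)
    assume "j \<noteq> Suc i"
    then have ij: "i < Suc i" "Suc i < j" using that by auto
    have "i \<in> {1..p}" "j \<in> {1..p}" using that(1) hole_range(1) by blast+
    then have "left_hole (Suc i) \<in> \<Union>P" unfolding hole_range using ij by auto
    then obtain e where e: "e \<in> P" "left_hole (Suc i) \<in> e" by blast
    then obtain v where v: "e = {left_hole (Suc i), v}" using pair[OF e] by blast
    then have "{left_hole i, left_hole j} = {left_hole (Suc i), v}"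
      using disj[OF that(1) _ between_holes(1)[OF ij]] e by auto
    then show False using ij by (auto simp: doubleton_eq_iff)
  qed
  have adjacent_right: "j = Suc i" if "{right_hole i, right_hole j} \<in> P" "i < j" for i j
  proof (rule ccontr)
    assume "j \<noteq> Suc i"
    then have ij: "i < Suc i" "Suc i < j" using that by auto
    have "i \<in> {1..q}" "j \<in> {1..q}" using that(1) hole_range(2) by blast+
    then have "right_hole (Suc i) \<in> \<Union>P" unfolding hole_range using ij by auto
    then obtain e where e: "e \<in> P" "right_hole (Suc i) \<in> e" by blast
    then obtain v where v: "e = {right_hole (Suc i), v}" using pair[OF e] by blast
    then have "{right_hole i, right_hole j} = {right_hole (Suc i), v}"
      using disj[OF that(1) _ between_holes(2)[OF ij]] e by auto
    then show False using ij by (auto simp: doubleton_eq_iff)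
  qed
  show A: "A \<in> sparse p"
  proof -
    have "i \<in> {1..<p}" if "i \<in> A" for i
    proof -
      have "left_hole i \<in> \<Union>P" "left_hole (Suc i) \<in> \<Union>P"
        using that unfolding A_def left_pairs_def by blast+
      then show ?thesis unfolding hole_range by auto
    qed
    moreover have "Suc i \<notin> A" if "i \<in> A" for i
    proof
      assume "Suc i \<in> A"
      then have "{left_hole i, left_hole (Suc i)} = {left_hole (Suc i), left_hole (Suc (Suc i))}"
        using that by (intro same[of _ _ "left_hole (Suc i)"]) (auto simp: A_def left_pairs_def)
      then show False by (auto simp: doubleton_eq_iff)
    qed
    ultimately show ?thesis by (auto simp: sparse_def)
  qed
  show B: "B \<in> sparse q"
  proof -
    have "i \<in> {1..<q}" if "i \<in> B" for i
    proof -
      have "right_hole i \<in> \<Union>P" "right_hole (Suc i) \<in> \<Union>P"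
        using that unfolding B_def right_pairs_def by blast+
      then show ?thesis unfolding hole_range by auto
    qed
    moreover have "Suc i \<notin> B" if "i \<in> B" for i
    proof
      assume "Suc i \<in> B"
      then have "{right_hole i, right_hole (Suc i)} = {right_hole (Suc i), right_hole (Suc (Suc i))}"
        using that by (intro same[of _ _ "right_hole (Suc i)"]) (auto simp: B_def right_pairs_def)
      then show False by (auto simp: doubleton_eq_iff)
    qed
    ultimately show ?thesis by (auto simp: sparse_def)
  qed
  define M where "M i j \<longleftrightarrow> {left_hole i, right_hole j} \<in> P" for i j
  have M_free: "i \<in> free p A" "j \<in> free q B" if "M i j" for i j
  proof -
    have "i \<in> {1..p}" "j \<in> {1..q}"
      using that hole_range unfolding M_def by blast+
    moreover have "i \<notin> A" "i \<notin> Suc ` A"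
      using same[of "{left_hole i, right_hole j}" _ "left_hole i"] that
      by (fastforce simp: M_def A_def left_pairs_def doubleton_eq_iff)+
    moreover have "j \<notin> B" "j \<notin> Suc ` B"
      using same[of "{left_hole i, right_hole j}" _ "right_hole j"] that
      by (fastforce simp: M_def B_def right_pairs_def doubleton_eq_iff)+
    ultimately show "i \<in> free p A" "j \<in> free q B" by (auto simp: free_def)
  qed
  have left_mate: "\<exists>j. M i j" if "i \<in> free p A" for i
  proof -
    have "left_hole i \<in> \<Union>P" unfolding hole_range using that by (auto simp: free_def)
    then obtain e where e: "e \<in> P" "left_hole i \<in> e" by blast
    then obtain v where v: "e = {left_hole i, v}" "left_hole i \<noteq> v" "v \<in> marked p q"
      using pair[OF e] by blast
    then show ?thesis
    proof (cases "v \<in> left_hole ` {1..p}")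
      case True
      then obtain k where k: "v = left_hole k" by blast
      then have "k = Suc i \<or> i = Suc k"
        using adjacent_left[of i k] adjacent_left[of k i] v e(1)
        by (cases i k rule: linorder_cases) (auto simp: insert_commute)
      then show ?thesis
        using that e(1) v(1) k by (auto simp: free_def A_def left_pairs_def insert_commute)
    qed (use e(1) in \<open>auto simp: M_def\<close>)
  qed
  have right_mate: "\<exists>i. M i j" if "j \<in> free q B" for j
  proof -
    have "right_hole j \<in> \<Union>P" unfolding hole_range using that by (auto simp: free_def)
    then obtain e where e: "e \<in> P" "right_hole j \<in> e" by blast
    then obtain v where v: "e = {right_hole j, v}" "right_hole j \<noteq> v" "v \<in> marked p q"
      using pair[OF e] by blast
    then show ?thesis
    proof (cases "v \<in> right_hole ` {1..q}")
      case True
      then obtain k where k: "v = right_hole k" by blast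
      then have "k = Suc j \<or> j = Suc k"
        using adjacent_right[of j k] adjacent_right[of k j] v e(1)
        by (cases j k rule: linorder_cases) (auto simp: insert_commute)
      then show ?thesis
        using that e(1) v(1) k by (auto simp: free_def B_def right_pairs_def insert_commute)
    qed (use e(1) in \<open>auto simp: M_def insert_commute\<close>)
  qed
  have mono: "j < l" if "M i j" "M k l" "i < k" for i j k l
  proof -
    have ne: "{left_hole i, right_hole j} \<noteq> {left_hole k, right_hole l}"
      using that(3) by (simp add: doubleton_eq_iff)
    have "closed_segment (left_hole i) (right_hole j) \<inter> closed_segment (left_hole k) (right_hole l) = {}"
      using sep[OF _ _ ne] that(1,2) unfolding separated_def M_def by blast
    \<comment> \<open>Since \<open>i < k\<close>, the first factor is negative; so is the second,
      which says that \<open>right_hole l\<close> lies below \<open>right_hole j\<close>.\<close>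
    then have "side (left_hole i) (right_hole j) (left_hole k) *
        side (left_hole i) (right_hole j) (right_hole l) > 0"
      by (intro disjoint_segments_same_side) auto
    then show ?thesis
      using that(3) by (auto simp: side_first side_second zero_less_mult_iff)
  qed
  have unique: "j = l" if "M i j" "M i l" for i j l
    using same[of "{left_hole i, right_hole j}" "{left_hole i, right_hole l}" "left_hole i"] that
    by (auto simp: M_def doubleton_eq_iff)
  define f where "f i = (SOME j. M i j)" for i
  have f: "M i j \<longleftrightarrow> i \<in> free p A \<and> j = f i" for i j
    using M_free(1) left_mate unique someI_ex[of "M i"] unfolding f_def by blast
  have f_mono: "i < k \<Longrightarrow> i \<in> free p A \<Longrightarrow> k \<in> free p A \<Longrightarrow> f i < f k" for i k
    using mono[of i "f i" k "f k"] by (simp add: f)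
  then have inj: "inj_on f (free p A)"
    by (intro linorder_inj_onI) (auto simp: less_imp_neq)
  have image: "f ` free p A = free q B"
    using right_mate M_free(2) f by (auto simp: image_iff)
  show card: "card (free p A) = card (free q B)"
    using card_image[OF inj] image by simp
  have rank: "rank (free p A) i = rank (free q B) (f i)" if "i \<in> free p A" for i
  proof -
    have "f k < f i \<longleftrightarrow> k < i" if "k \<in> free p A" for k
      using f_mono[of k i] f_mono[of i k] \<open>i \<in> free p A\<close> that
      by (cases i k rule: linorder_cases) auto
    then have "{j \<in> free q B. j < f i} = f ` {k \<in> free p A. k < i}"
      unfolding image[symmetric] by blast
    then show ?thesis
      using card_image[OF inj_on_subset[OF inj, of "{k \<in> free p A. k < i}"]] by (auto simp: rank_def)
  qed
  have sub: "P \<subseteq> pairing p q A B"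
  proof
    fix e assume e: "e \<in> P"
    have "e \<noteq> {}" using two[OF e] by auto
    then obtain x where "x \<in> e" by blast
    then obtain v where v: "e = {x, v}" "x \<noteq> v" "v \<in> marked p q" using pair[OF e \<open>x \<in> e\<close>] by blast
    have "x \<in> marked p q" using e \<open>x \<in> e\<close> un by blast
    then consider i k where "x = left_hole i" "v = left_hole k" | i k where "x = right_hole i" "v = right_hole k"
      | i j where "e = {left_hole i, right_hole j}"
      using v by blast
    then show "e \<in> pairing p q A B"
    proof cases
      case (1 i k)
      then show ?thesis
        using adjacent_left[of i k] adjacent_left[of k i] v e
        by (cases i k rule: linorder_cases) (auto simp: insert_commute pairing_def A_def left_pairs_def)
    next
      case (2 i k)
      then show ?thesis
        using adjacent_right[of i k] adjacent_right[of k i] v e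
        by (cases i k rule: linorder_cases) (auto simp: insert_commute pairing_def B_def right_pairs_def)
    next
      case (3 i j)
      then have M: "M i j" using e by (simp add: M_def)
      then have "rank (free p A) i = rank (free q B) j"
        using rank[of i] f[of i j] by simp
      then show ?thesis
        using 3 M_free[OF M] unfolding pairing_def by blast
    qed
  qed
  \<comment> \<open>A point of \<open>e\<close> lies in some edge of \<open>P\<close>, which by
    \<open>sub\<close> is an edge of the pairing too; two blocks of a partition with a common point
    coincide.\<close>
  have "e \<in> P" if e: "e \<in> pairing p q A B" for e
  proof -
    note nc = pairing_noncrossing[OF A B card]
    note nc_iff = nc[unfolded noncrossing_pairings_iff]
    have "card e = 2"
      using conjunct1[OF conjunct2[OF nc_iff]] e by simp
    then have "e \<noteq> {}" by auto
    moreover have "e \<subseteq> marked p q"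
      using conjunct1[OF nc_iff] e by (metis Union_upper)
    ultimately obtain x where "x \<in> e" "x \<in> \<Union>P" unfolding un by blast
    then obtain e' where e': "e' \<in> P" "x \<in> e'" by blast
    have "e = e'"
      using nc e e' sub \<open>x \<in> e\<close> unfolding noncrossing_pairings_def partition_on_def disjoint_def by blast
    then show ?thesis using e' by simp
  qed
  then show "P = pairing p q A B" using sub by blast
qed

lemma a_count_eq_card_sparse_pairs:
  "a_count n n = card {(A, B). A \<in> sparse n \<and> B \<in> sparse n \<and> card A = card B}" (is "_ = card ?S")
proof -
  have free: "card (free n A) = card (free n B) \<longleftrightarrow> card A = card B"
    if "A \<in> sparse n" "B \<in> sparse n" for A B
    using card_free[OF that(1)] card_free[OF that(2)] by linarith
  have "bij_betw (\<lambda>(A, B). pairing n n A B) ?S (noncrossing_pairings (marked n n))"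
  proof (rule bij_betwI[where g = "\<lambda>P. (left_pairs P, right_pairs P)"])
    show "(\<lambda>(A, B). pairing n n A B) \<in> ?S \<rightarrow> noncrossing_pairings (marked n n)"
      using pairing_noncrossing free by auto
    show "(\<lambda>P. (left_pairs P, right_pairs P)) \<in> noncrossing_pairings (marked n n) \<rightarrow> ?S"
      using noncrossing_pairing_decompose[of _ n n] free by (auto simp del: Un_iff)
    show "(\<lambda>(A, B). pairing n n A B) (left_pairs P, right_pairs P) = P"
      if "P \<in> noncrossing_pairings (marked n n)" for P
      using noncrossing_pairing_decompose(4)[OF that] by simp
  qed (auto simp: left_pairs_pairing right_pairs_pairing)
  from bij_betw_same_card[OF this] show ?thesis
    by (simp add: a_count_def)
qed

section \<open>Words without triple letters\<close>

text \<open>Indexed in the same way as the condition in \<open>lacing_sequence\<close>, which is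
  this property of the list of column coordinates.\<close>

definition no_triple :: "'a list \<Rightarrow> bool" where
  "no_triple w \<longleftrightarrow>
    (\<forall>i. 0 < i \<and> i + 1 < length w \<longrightarrow> w ! (i - 1) \<noteq> w ! i \<or> w ! (i + 1) \<noteq> w ! i)"

lemma no_triple_Cons_Cons_Cons:
  "no_triple (a # b # c # w) \<longleftrightarrow> (a \<noteq> b \<or> c \<noteq> b) \<and> no_triple (b # c # w)"
proof -
  have *: "no_triple w \<longleftrightarrow> (\<forall>i. Suc (Suc i) < length w \<longrightarrow> w ! i \<noteq> w ! Suc i \<or> w ! Suc (Suc i) \<noteq> w ! Suc i)"
    for w :: "'a list"
    unfolding no_triple_def by (auto simp: gr0_conv_Suc)
  show ?thesis
    unfolding * by (auto simp: All_less_Suc2 nth_Cons split: nat.splits)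
qed

lemma no_triple_Cons_Cons: "a \<noteq> b \<Longrightarrow> no_triple (a # b # w) \<longleftrightarrow> no_triple (b # w)"
  by (cases w) (auto simp: no_triple_Cons_Cons_Cons, auto simp: no_triple_def)

lemma no_triple_short: "length w \<le> 2 \<Longrightarrow> no_triple w"
  by (auto simp: no_triple_def)

text \<open>\<open>True\<close> stands for the left column; the two lists supply the lengths of the
  left and the right runs.\<close>

fun word :: "nat list \<Rightarrow> nat list \<Rightarrow> bool list" where
  "word (c # cs) (d # ds) = replicate c True @ replicate d False @ word cs ds"
| "word _ _ = []"

definition words :: "nat \<Rightarrow> nat \<Rightarrow> bool list set" where
  "words p q = {w. count_list w True = p \<and> count_list w False = q \<and> no_triple w \<and>
    (w \<noteq> [] \<longrightarrow> hd w \<and> \<not> last w)}"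

lemma count_list_replicate: "count_list (replicate k x) y = (if x = y then k else 0)"
  by (induction k) auto

lemma word_in_words:
  assumes "length cs = length ds" "cs \<in> tilings p" "ds \<in> tilings q"
  shows "word cs ds \<in> words p q"
  using assms
proof (induction cs ds arbitrary: p q rule: list_induct2)
  case Nil
  then show ?case
    by (simp add: Nil_in_tilings words_def no_triple_short)
next
  case (Cons c cs d ds)
  have w: "word cs ds \<in> words (p - c) (q - d)"
    using Cons.prems by (intro Cons.IH) (auto simp: Cons_in_tilings)
  have cd: "c \<in> {1, 2}" "d \<in> {1, 2}" "c \<le> p" "d \<le> q"
    using Cons.prems by (auto simp: Cons_in_tilings)
  have "no_triple (replicate c True @ replicate d False @ word cs ds)"
  proof (cases "word cs ds")
    case Nil
    then show ?thesis
      using cd(1,2) by (auto simp: numeral_2_eq_2 no_triple_Cons_Cons_Cons no_triple_short)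
  next
    case (Cons x v)
    then have "x" "no_triple (True # v)"
      using w by (auto simp: words_def)
    then show ?thesis
      using cd(1,2) Cons
      by (auto simp: numeral_2_eq_2 no_triple_Cons_Cons_Cons no_triple_Cons_Cons)
  qed
  moreover have "hd (replicate c True @ replicate d False @ word cs ds)"
    using cd(1) by (auto simp: numeral_2_eq_2)
  moreover have "\<not> last (replicate c True @ replicate d False @ word cs ds)"
    using cd(2) w by (cases "word cs ds = []") (auto simp: numeral_2_eq_2 words_def)
  ultimately show ?case
    using w cd(3,4) by (simp add: words_def count_list_replicate)
qed

lemma word_hd: "word cs ds \<noteq> [] \<Longrightarrow> 0 \<notin> set cs \<Longrightarrow> hd (word cs ds)"
  by (cases "(cs, ds)" rule: word.cases) (auto simp: hd_append)

text \<open>The remaining word is empty or starts with \<open>True\<close>, so the displayed runs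
  are maximal and can be read off again. This is what makes \<open>word\<close> injective.\<close>

lemma word_Cons_decode:
  fixes c :: nat and ds :: "nat list"
  assumes "0 < d" "0 \<notin> set cs"
  defines "w \<equiv> word (c # cs) (d # ds)"
  shows "takeWhile id w = replicate c True" "dropWhile id w = replicate d False @ word cs ds"
    "takeWhile Not (dropWhile id w) = replicate d False" "dropWhile Not (dropWhile id w) = word cs ds"
proof -
  have hd: "word cs ds = [] \<or> hd (word cs ds)"
    using word_hd assms by blast
  obtain d' where d: "d = Suc d'" using assms by (cases d) auto
  show "takeWhile id w = replicate c True"
    unfolding w_def d by (simp add: takeWhile_append)
  show drop: "dropWhile id w = replicate d False @ word cs ds"
    unfolding w_def d by (simp add: dropWhile_append)
  show "takeWhile Not (dropWhile id w) = replicate d False"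
    unfolding drop using hd by (cases "word cs ds") (simp_all add: takeWhile_append)
  show "dropWhile Not (dropWhile id w) = word cs ds"
    unfolding drop using hd by (cases "word cs ds") (simp_all add: dropWhile_append)
qed

lemma word_inject:
  assumes "length cs = length ds" "length cs' = length ds'"
    "0 \<notin> set cs \<union> set ds \<union> set cs' \<union> set ds'" "word cs ds = word cs' ds'"
  shows "cs = cs' \<and> ds = ds'"
  using assms
proof (induction cs ds arbitrary: cs' ds' rule: list_induct2)
  case Nil
  then show ?case by (cases cs'; cases ds') auto
next
  case (Cons c cs d ds)
  have "word (c # cs) (d # ds) \<noteq> []"
    using Cons.prems(2) by simp
  then obtain c' cs2 d' ds2 where eq: "cs' = c' # cs2" "ds' = d' # ds2"
    using Cons.prems(3) by (metis list.exhaust word.simps(2,3))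
  have pos: "0 < d" "0 \<notin> set cs" "0 < d'" "0 \<notin> set cs2"
    using Cons.prems(2) by (auto simp: eq)
  note l = word_Cons_decode[OF pos(1,2), of c ds] and r = word_Cons_decode[OF pos(3,4), of c' ds2]
  have "replicate c True = replicate c' True"
    using l(1) r(1) Cons.prems(3) by (simp only: eq)
  moreover have "replicate d False = replicate d' False"
    using l(3) r(3) Cons.prems(3) by (simp only: eq)
  moreover have "word cs ds = word cs2 ds2"
    using l(4) r(4) Cons.prems(3) by (simp only: eq)
  moreover from this have "cs = cs2 \<and> ds = ds2"
    using Cons.prems(1,2) by (intro Cons.IH) (simp_all add: eq)
  ultimately show ?case
    by (simp add: eq)
qed

text \<open>\<open>no_triple\<close> limits each run to length 2, and the final letter
  \<open>False\<close> guarantees that the left run is followed by a right one.\<close>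

lemma words_Cons:
  assumes "w \<in> words p q" "w \<noteq> []"
  obtains c d v where "c \<in> {1, 2}" "d \<in> {1, 2}" "c \<le> p" "d \<le> q"
    "v \<in> words (p - c) (q - d)" "w = replicate c True @ replicate d False @ v"
proof -
  have tail: "v \<in> words (p - c) (q - d)"
    if w: "w = replicate c True @ replicate d False @ v" and "no_triple v" "v \<noteq> [] \<longrightarrow> hd v" for c d v
  proof -
    have "last w = last v" if "v \<noteq> []"
      using w that by simp
    moreover have "count_list w True = p" "count_list w False = q" "\<not> last w"
      using assms by (simp_all add: words_def)
    moreover have "count_list w True = c + count_list v True" "count_list w False = d + count_list v False"
      unfolding w by (simp_all add: count_list_replicate)
    ultimately show ?thesis
      using that(2,3) unfolding words_def by auto
  qed
  have *: "no_triple v \<Longrightarrow> no_triple (tl v)" for v :: "bool list"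
    by (cases v rule: remdups_adj.cases; cases "tl (tl v)")
      (auto simp: no_triple_Cons_Cons_Cons no_triple_short)
  obtain c u where c: "c \<in> {1, 2}" "w = replicate c True @ False # u" "no_triple (False # u)"
  proof -
    obtain w1 where w1: "w = True # w1" using assms by (cases w) (auto simp: words_def)
    then obtain b w2 where w2: "w1 = b # w2" using assms by (cases w1) (auto simp: words_def)
    show ?thesis
    proof (cases b)
      case False
      then show ?thesis
        using that[of 1 w2] w1 w2 assms *[of w] by (auto simp: words_def)
    next
      case True
      then obtain b' w3 where w3: "w2 = b' # w3" using assms w1 w2 by (cases w2) (auto simp: words_def)
      then have "\<not> b'" using True assms w1 w2 by (auto simp: words_def no_triple_Cons_Cons_Cons)
      then show ?thesis
        using that[of 2 w3] True w1 w2 w3 assms *[of w] *[of "tl w"] by (auto simp: words_def numeral_2_eq_2)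
    qed
  qed
  obtain d v where d: "d \<in> {1, 2}" "False # u = replicate d False @ v" "no_triple v" "v \<noteq> [] \<longrightarrow> hd v"
  proof (cases u)
    case Nil
    then show ?thesis using that[of 1 "[]"] by (auto simp: no_triple_short)
  next
    case (Cons b u2)
    note b = Cons
    show ?thesis
    proof (cases b)
      case True
      then show ?thesis using that[of 1 u] c(3) b *[of "False # u"] by auto
    next
      case False
      have "u2 \<noteq> [] \<longrightarrow> hd u2"
        using c(3) False b by (cases u2) (auto simp: no_triple_Cons_Cons_Cons)
      then show ?thesis
        using that[of 2 u2] c(3) b False *[of "False # u"] *[of u] by (auto simp: numeral_2_eq_2)
    qed
  qed
  have w: "w = replicate c True @ replicate d False @ v"
    using c d by auto
  then have "v \<in> words (p - c) (q - d)"
    using d(3,4) by (rule tail)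
  moreover have "c \<le> p" "d \<le> q"
    using assms(1) w by (auto simp: words_def count_list_replicate)
  ultimately show ?thesis
    using that[OF c(1) d(1) _ _ _ w] by simp
qed

lemma words_imp_word:
  assumes "w \<in> words p q"
  shows "\<exists>cs ds. cs \<in> tilings p \<and> ds \<in> tilings q \<and> length cs = length ds \<and> word cs ds = w"
  using assms
proof (induction "length w" arbitrary: w p q rule: less_induct)
  case less
  show ?case
  proof (cases "w = []")
    case True
    then show ?thesis
      using less.prems by (intro exI[of _ "[]"]) (auto simp: words_def Nil_in_tilings)
  next
    case False
    obtain c d v where v: "c \<in> {1, 2}" "d \<in> {1, 2}" "c \<le> p" "d \<le> q"
      "v \<in> words (p - c) (q - d)" "w = replicate c True @ replicate d False @ v"
      using words_Cons[OF less.prems False] by blast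
    then have "length v < length w" by auto
    from less.hyps[OF this v(5)] obtain cs ds where
      "cs \<in> tilings (p - c)" "ds \<in> tilings (q - d)" "length cs = length ds" "word cs ds = v"
      by blast
    then have "c # cs \<in> tilings p \<and> d # ds \<in> tilings q \<and> length (c # cs) = length (d # ds) \<and>
        word (c # cs) (d # ds) = w"
      using v by (simp add: Cons_in_tilings)
    then show ?thesis by blast
  qed
qed

lemma card_words:
  "card (words p q) = card {(cs, ds). cs \<in> tilings p \<and> ds \<in> tilings q \<and> length cs = length ds}"
proof -
  have "bij_betw (\<lambda>(cs, ds). word cs ds)
      {(cs, ds). cs \<in> tilings p \<and> ds \<in> tilings q \<and> length cs = length ds} (words p q)"
    unfolding bij_betw_def
  proof
    show "inj_on (\<lambda>(cs, ds). word cs ds) {(cs, ds). cs \<in> tilings p \<and> ds \<in> tilings q \<and> length cs = length ds}"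
    proof (rule inj_onI, clarify)
      fix cs ds cs' ds'
      assume "cs \<in> tilings p" "ds \<in> tilings q" "cs' \<in> tilings p" "ds' \<in> tilings q"
        "length cs = length ds" "length cs' = length ds'" "word cs ds = word cs' ds'"
      then show "cs = cs' \<and> ds = ds'"
        by (intro word_inject) (auto simp: tilings_def subset_iff)
    qed
    show "(\<lambda>(cs, ds). word cs ds) ` {(cs, ds). cs \<in> tilings p \<and> ds \<in> tilings q \<and> length cs = length ds} = words p q"
      using word_in_words words_imp_word by (force simp: image_iff)
  qed
  from bij_betw_same_card[OF this] show ?thesis by simp
qed

section \<open>Lacings\<close>

lemma filter_map_eqD:
  assumes "map P xs = map P ys" "filter P xs = filter P ys" "filter (\<lambda>x. \<not> P x) xs = filter (\<lambda>x. \<not> P x) ys"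
  shows "xs = ys"
  using assms
proof (induction xs arbitrary: ys)
  case (Cons x xs)
  then show ?case by (cases ys) (auto split: if_splits)
qed auto

lemma interleaving_exists:
  assumes "count_list w True = length ls" "count_list w False = length rs"
    "\<forall>x\<in>set ls. P x" "\<forall>x\<in>set rs. \<not> P x"
  shows "\<exists>xs. map P xs = w \<and> filter P xs = ls \<and> filter (\<lambda>x. \<not> P x) xs = rs"
  using assms
proof (induction w arbitrary: ls rs)
  case Nil
  then show ?case by auto
next
  case (Cons b w)
  show ?case
  proof (cases b)
    case True
    then obtain l ls' where "ls = l # ls'" using Cons.prems by (cases ls) auto
    with Cons.IH[of ls' rs] Cons.prems True obtain xs where
      "map P xs = w \<and> filter P xs = ls' \<and> filter (\<lambda>x. \<not> P x) xs = rs" by auto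
    then show ?thesis
      using True Cons.prems \<open>ls = _\<close> by (intro exI[of _ "l # xs"]) auto
  next
    case False
    then obtain r rs' where "rs = r # rs'" using Cons.prems by (cases rs) auto
    with Cons.IH[of ls rs'] Cons.prems False obtain xs where
      "map P xs = w \<and> filter P xs = ls \<and> filter (\<lambda>x. \<not> P x) xs = rs'" by auto
    then show ?thesis
      using False Cons.prems \<open>rs = _\<close> by (intro exI[of _ "r # xs"]) auto
  qed
qed

text \<open>A list is determined by its word and its two sublists, and these three can be prescribed
  independently as long as the letter counts equal the lengths of the sublists.\<close>

lemma card_interleavings:
  assumes "\<And>w. w \<in> W \<Longrightarrow> count_list w True = p \<and> count_list w False = q"
    and "\<And>ls. ls \<in> X \<Longrightarrow> length ls = p \<and> (\<forall>x\<in>set ls. P x)"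
    and "\<And>rs. rs \<in> Y \<Longrightarrow> length rs = q \<and> (\<forall>x\<in>set rs. \<not> P x)"
  shows "card {xs. map P xs \<in> W \<and> filter P xs \<in> X \<and> filter (\<lambda>x. \<not> P x) xs \<in> Y} =
    card W * card X * card Y"
proof -
  have "bij_betw (\<lambda>xs. (map P xs, filter P xs, filter (\<lambda>x. \<not> P x) xs))
    {xs. map P xs \<in> W \<and> filter P xs \<in> X \<and> filter (\<lambda>x. \<not> P x) xs \<in> Y} (W \<times> X \<times> Y)"
    unfolding bij_betw_def
  proof
    show "inj_on (\<lambda>xs. (map P xs, filter P xs, filter (\<lambda>x. \<not> P x) xs))
      {xs. map P xs \<in> W \<and> filter P xs \<in> X \<and> filter (\<lambda>x. \<not> P x) xs \<in> Y}"
      by (rule inj_onI) (auto intro: filter_map_eqD)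
  next
    have "(w, ls, rs) \<in> (\<lambda>xs. (map P xs, filter P xs, filter (\<lambda>x. \<not> P x) xs)) `
      {xs. map P xs \<in> W \<and> filter P xs \<in> X \<and> filter (\<lambda>x. \<not> P x) xs \<in> Y}"
      if "w \<in> W" "ls \<in> X" "rs \<in> Y" for w ls rs
    proof -
      obtain xs where "map P xs = w \<and> filter P xs = ls \<and> filter (\<lambda>x. \<not> P x) xs = rs"
        using interleaving_exists[of w ls rs P] assms(1)[of w] assms(2)[of ls]
          assms(3)[of rs] \<open>w \<in> W\<close> \<open>ls \<in> X\<close> \<open>rs \<in> Y\<close> by auto
      then show ?thesis
        using that by (auto intro!: image_eqI[of _ _ xs])
    qed
    then show "(\<lambda>xs. (map P xs, filter P xs, filter (\<lambda>x. \<not> P x) xs)) `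
      {xs. map P xs \<in> W \<and> filter P xs \<in> X \<and> filter (\<lambda>x. \<not> P x) xs \<in> Y} = W \<times> X \<times> Y"
      by auto
  qed
  then have "card {xs. map P xs \<in> W \<and> filter P xs \<in> X \<and> filter (\<lambda>x. \<not> P x) xs \<in> Y} = card (W \<times> X \<times> Y)"
    by (rule bij_betw_same_card)
  then show ?thesis by (simp add: card_cartesian_product)
qed

section \<open>Lacings as interleavings of the two columns\<close>

abbreviation is_left :: "point \<Rightarrow> bool" where
  "is_left p \<equiv> fst p = 0"

lemma holes_cases:
  assumes "x \<in> holes n"
  obtains i where "i \<in> {1..n}" "x = left_hole i" | i where "i \<in> {1..n}" "x = right_hole i"
  using assms by (auto simp: holes_def)

lemma in_columns_holes: "x \<in> holes n \<Longrightarrow> in_columns x"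
  by (erule holes_cases) auto

lemma distinct_filter_iff:
  "distinct xs \<longleftrightarrow> distinct (filter P xs) \<and> distinct (filter (\<lambda>x. \<not> P x) xs)"
  by (induction xs) (auto simp del: distinct_filter)

lemma no_triple_map_iff:
  "no_triple (map f xs) \<longleftrightarrow> (\<forall>i. 0 < i \<and> i + 1 < length xs \<longrightarrow>
    f (xs ! (i - 1)) \<noteq> f (xs ! i) \<or> f (xs ! (i + 1)) \<noteq> f (xs ! i))"
proof -
  have "map f xs ! (i - 1) = f (xs ! (i - 1))" "map f xs ! i = f (xs ! i)"
    "map f xs ! (i + 1) = f (xs ! (i + 1))" if "i + 1 < length xs" for i
    using that by (intro nth_map; linarith)+
  then show ?thesis
    unfolding no_triple_def length_map by metis
qed

text \<open>There are only two columns, so \<open>is_left\<close> distinguishes the same holes as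
  the first coordinate does.\<close>

lemma no_triple_map:
  assumes "set xs \<subseteq> holes n"
  shows "no_triple (map is_left xs) \<longleftrightarrow> no_triple (map fst xs)"
proof -
  have *: "is_left (xs ! i) \<noteq> is_left (xs ! j) \<longleftrightarrow> fst (xs ! i) \<noteq> fst (xs ! j)"
    if "i < length xs" "j < length xs" for i j
  proof -
    have "in_columns (xs ! i)" "in_columns (xs ! j)"
      using that assms in_columns_holes by (meson nth_mem subsetD)+
    then show ?thesis by (auto simp: in_columns_def)
  qed
  have "(is_left (xs ! (i - 1)) \<noteq> is_left (xs ! i) \<or> is_left (xs ! (i + 1)) \<noteq> is_left (xs ! i)) \<longleftrightarrow>
      (fst (xs ! (i - 1)) \<noteq> fst (xs ! i) \<or> fst (xs ! (i + 1)) \<noteq> fst (xs ! i))"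
    if "0 < i" "i + 1 < length xs" for i
    using that by (intro arg_cong2[where f = "(\<or>)"] *) auto
  then show ?thesis
    unfolding no_triple_map_iff by blast
qed

text \<open>Separates the lacing property into conditions on the word and on each column alone, the
  form required by \<open>card_interleavings\<close>.\<close>

lemma lacing_sequence_iff:
  "lacing_sequence n xs \<longleftrightarrow> no_triple (map is_left xs) \<and>
    filter is_left xs \<in> permutations_of_set (left_hole ` {1..n}) \<and>
    filter (\<lambda>x. \<not> is_left x) xs \<in> permutations_of_set (right_hole ` {1..n})"
proof -
  have set: "set xs = holes n \<longleftrightarrow>
      set (filter is_left xs) = left_hole ` {1..n} \<and>
      set (filter (\<lambda>x. \<not> is_left x) xs) = right_hole ` {1..n}" (is "_ \<longleftrightarrow> ?R")
  proof
    assume "set xs = holes n"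
    then show ?R by (auto simp: holes_def)
  next
    assume ?R
    moreover have "set xs = set (filter is_left xs) \<union> set (filter (\<lambda>x. \<not> is_left x) xs)"
      by auto
    ultimately show "set xs = holes n" by (simp only: holes_def)
  qed
  have triple: "(\<forall>i. 0 < i \<and> i + 1 < length xs \<longrightarrow>
      fst (xs ! (i - 1)) \<noteq> fst (xs ! i) \<or> fst (xs ! (i + 1)) \<noteq> fst (xs ! i)) \<longleftrightarrow>
      no_triple (map fst xs)"
    by (simp only: no_triple_map_iff)
  show ?thesis
  proof (cases "set xs = holes n")
    case True
    with set have R: "set (filter is_left xs) = left_hole ` {1..n}"
      "set (filter (\<lambda>x. \<not> is_left x) xs) = right_hole ` {1..n}"
      by blast+
    have "no_triple (map is_left xs) \<longleftrightarrow> no_triple (map fst xs)"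
      using no_triple_map[of xs n] True by simp
    then show ?thesis
      unfolding lacing_sequence_def triple permutations_of_set_def mem_Collect_eq
      using True R distinct_filter_iff[of xs is_left] by argo
  next
    case False
    with set show ?thesis
      unfolding lacing_sequence_def permutations_of_set_def mem_Collect_eq by argo
  qed
qed

lemma hd_filter: "xs \<noteq> [] \<Longrightarrow> P (hd xs) \<Longrightarrow> hd (filter P xs) = hd xs"
  by (cases xs) auto

lemma last_filter: "xs \<noteq> [] \<Longrightarrow> P (last xs) \<Longrightarrow> last (filter P xs) = last xs"
  by (cases xs rule: rev_cases) auto

lemma count_list_map_True_False:
  "count_list (map P xs) True = length (filter P xs)"
  "count_list (map P xs) False = length (filter (\<lambda>x. \<not> P x) xs)"
  by (induction xs) auto

lemma length_permutation_holes:
  "ls \<in> permutations_of_set (left_hole ` {1..n}) \<Longrightarrow> length ls = n"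
  "rs \<in> permutations_of_set (right_hole ` {1..n}) \<Longrightarrow> length rs = n"
  by (simp_all add: length_finite_permutations_of_set card_image inj_on_def)

text \<open>Prescribed ends separate in the same way: the word fixes the columns of the two ends,
  and then the first left hole and the last right hole are the ends themselves. The cases
  \<open>m = 1\<close> and \<open>m = n\<close> are the two kinds of lacing.\<close>

lemma lacing_with_ends_iff:
  assumes "n \<ge> 1"
  shows "lacing_sequence n xs \<and> hd xs = left_hole 1 \<and> last xs = right_hole m \<longleftrightarrow>
    map is_left xs \<in> words n n \<and>
    filter is_left xs \<in> {ls \<in> permutations_of_set (left_hole ` {1..n}). hd ls = left_hole 1} \<and>
    filter (\<lambda>x. \<not> is_left x) xs \<in>
      {rs \<in> permutations_of_set (right_hole ` {1..n}). last rs = right_hole m}"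
    (is "?L \<longleftrightarrow> ?R")
proof
  assume L: ?L
  then have xs: "xs \<noteq> []" using assms by (auto simp: lacing_sequence_def holes_def)
  note perms = L[unfolded lacing_sequence_iff]
  have "map is_left xs \<in> words n n"
    using perms length_permutation_holes xs
    by (auto simp: words_def count_list_map_True_False hd_map last_map)
  then show ?R
    using perms xs hd_filter[of xs is_left] last_filter[of xs "\<lambda>x. \<not> is_left x"] by simp
next
  assume R: ?R
  then have "length (filter is_left xs) = n"
    using length_permutation_holes(1) by blast
  then have "filter is_left xs \<noteq> []"
    using assms by auto
  then have xs: "xs \<noteq> []" by auto
  then have "is_left (hd xs)" "\<not> is_left (last xs)"
    using R by (auto simp: words_def hd_map last_map)
  then show ?L
    using R xs hd_filter[of xs is_left] last_filter[of xs "\<lambda>x. \<not> is_left x"]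
    by (simp add: lacing_sequence_iff words_def)
qed

section \<open>Orders with a prescribed end, and the orientation of a lacing\<close>

lemma card_permutations_with_hd:
  assumes "finite S" "a \<in> S"
  shows "card {xs \<in> permutations_of_set S. hd xs = a} = fact (card S - 1)"
proof -
  have "{xs \<in> permutations_of_set S. hd xs = a} = Cons a ` permutations_of_set (S - {a})"
  proof (intro equalityI subsetI)
    fix xs assume xs: "xs \<in> {xs \<in> permutations_of_set S. hd xs = a}"
    then have "xs \<noteq> []" using assms by (auto simp: permutations_of_set_def)
    then have "xs = a # tl xs" using xs by (cases xs) auto
    moreover from this have "tl xs \<in> permutations_of_set (S - {a})"
      using xs by (cases xs) (auto simp: permutations_of_set_def)
    ultimately show "xs \<in> Cons a ` permutations_of_set (S - {a})" by blast
  next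
    fix xs assume "xs \<in> Cons a ` permutations_of_set (S - {a})"
    then obtain ys where "xs = a # ys" "set ys = S - {a}" "distinct ys"
      by (auto simp: permutations_of_set_def)
    then show "xs \<in> {xs \<in> permutations_of_set S. hd xs = a}"
      using assms by (simp add: permutations_of_set_def insert_absorb)
  qed
  then show ?thesis
    using assms by (simp add: card_image)
qed

lemma card_permutations_with_last:
  assumes "finite S" "a \<in> S"
  shows "card {xs \<in> permutations_of_set S. last xs = a} = fact (card S - 1)"
proof -
  have "{xs \<in> permutations_of_set S. last xs = a} = rev ` {xs \<in> permutations_of_set S. hd xs = a}"
  proof (intro equalityI subsetI)
    fix xs assume "xs \<in> {xs \<in> permutations_of_set S. last xs = a}"
    then show "xs \<in> rev ` {xs \<in> permutations_of_set S. hd xs = a}"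
      by (intro image_eqI[of _ _ "rev xs"]) (auto simp: permutations_of_set_def hd_rev)
  qed (auto simp: permutations_of_set_def last_rev)
  then show ?thesis
    by (simp add: card_image card_permutations_with_hd[OF assms])
qed

lemma lacing_sequence_rev:
  assumes "lacing_sequence n xs"
  shows "lacing_sequence n (rev xs)"
  unfolding lacing_sequence_def
proof (intro conjI allI impI)
  fix i assume i: "0 < i \<and> i + 1 < length (rev xs)"
  define k where "k = length xs - Suc i"
  have "0 < k" "k + 1 < length xs" using i by (auto simp: k_def)
  then have "fst (xs ! (k - 1)) \<noteq> fst (xs ! k) \<or> fst (xs ! (k + 1)) \<noteq> fst (xs ! k)"
    using assms unfolding lacing_sequence_def by blast
  moreover have "rev xs ! i = xs ! k" "rev xs ! (i + 1) = xs ! (k - 1)" "rev xs ! (i - 1) = xs ! (k + 1)"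
    using i by (auto simp: rev_nth k_def intro!: arg_cong[of _ _ "(!) xs"])
  ultimately show "fst (rev xs ! (i - 1)) \<noteq> fst (rev xs ! i) \<or> fst (rev xs ! (i + 1)) \<noteq> fst (rev xs ! i)"
    by auto
qed (use assms in \<open>auto simp: lacing_sequence_def\<close>)

text \<open>Distinct prescribed ends select one of the two orientations of a lacing.\<close>
lemma card_lacings_with_ends:
  assumes ends: "\<And>xs. Q xs \<Longrightarrow> hd xs = a \<and> last xs = b" and "a \<noteq> b"
  shows "card {l \<in> lacings n. \<exists>xs\<in>l. Q xs} = card {xs. lacing_sequence n xs \<and> Q xs}"
proof -
  have "{l \<in> lacings n. \<exists>xs\<in>l. Q xs} = (\<lambda>xs. {xs, rev xs}) ` {xs. lacing_sequence n xs \<and> Q xs}"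
    using lacing_sequence_rev by (fastforce simp: lacings_def image_iff insert_commute)
  moreover have "inj_on (\<lambda>xs. {xs, rev xs}) {xs. lacing_sequence n xs \<and> Q xs}"
  proof (rule inj_onI)
    fix xs ys assume xs: "xs \<in> {xs. lacing_sequence n xs \<and> Q xs}"
      and ys: "ys \<in> {xs. lacing_sequence n xs \<and> Q xs}" and eq: "{xs, rev xs} = {ys, rev ys}"
    have "ys \<noteq> rev xs"
      using ends[of xs] ends[of ys] xs ys \<open>a \<noteq> b\<close> by (auto simp: hd_rev)
    then show "xs = ys" using eq by (auto simp: doubleton_eq_iff)
  qed
  ultimately show ?thesis by (simp add: card_image)
qed

section \<open>Self-intersections and the order inside the columns\<close>

definition descending :: "point list \<Rightarrow> bool" where
  "descending xs \<longleftrightarrow> sorted_wrt (\<lambda>p q. fst p = fst q \<longrightarrow> snd q < snd p) xs"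

lemma descending_iff_filter:
  assumes "set xs \<subseteq> holes n"
  shows "descending xs \<longleftrightarrow>
    sorted_wrt (\<lambda>p q. snd q < snd p) (filter is_left xs) \<and>
    sorted_wrt (\<lambda>p q. snd q < snd p) (filter (\<lambda>x. \<not> is_left x) xs)"
  using assms
proof (induction xs)
  case (Cons x xs)
  have col: "in_columns y" if "y \<in> set (x # xs)" for y
    using Cons.prems that in_columns_holes by blast
  have "fst x = fst y \<longleftrightarrow> is_left x = is_left y" if "y \<in> set xs" for y
    using col[of x] col[of y] that by (auto simp: in_columns_def)
  then have "(\<forall>y\<in>set xs. fst x = fst y \<longrightarrow> snd y < snd x) \<longleftrightarrow>
      (\<forall>y\<in>set xs. is_left x = is_left y \<longrightarrow> snd y < snd x)"
    by blast
  then show ?case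
    using Cons.IH Cons.prems unfolding descending_def by auto
qed (simp add: descending_def)

lemma sorted_wrt_snd_unique:
  fixes xs ys :: "point list"
  assumes "sorted_wrt (\<lambda>p q. snd q < snd p) xs" "sorted_wrt (\<lambda>p q. snd q < snd p) ys"
    and "set xs = set ys" "inj_on snd (set xs)"
  shows "xs = ys"
proof -
  \<comment> \<open>Negated heights increase, so uniqueness of a strictly sorted list with a given
    set of entries applies.\<close>
  have "map (\<lambda>p. - snd p) ys = map (\<lambda>p. - snd p) xs"
    using assms(1-3) by (intro strict_sorted_equal) (auto simp: sorted_wrt_map)
  then have "map snd xs = map snd ys"
    by (metis (no_types, lifting) map_eq_conv list.map_comp comp_apply minus_minus map_map)
  then show ?thesis
    using assms(3,4) by (metis map_inj_on Un_absorb)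
qed

text \<open>Leaves a single possible order in each column, so that a descending lacing is determined
  by its word.\<close>

lemma descending_iff:
  assumes "lacing_sequence n xs"
  shows "descending xs \<longleftrightarrow> filter is_left xs = map left_hole [1..<Suc n] \<and>
    filter (\<lambda>x. \<not> is_left x) xs = map right_hole [1..<Suc n]"
proof -
  have sub: "set xs \<subseteq> holes n"
    using assms by (simp add: lacing_sequence_def)
  have sets: "set (filter is_left xs) = set (map left_hole [1..<Suc n])"
    "set (filter (\<lambda>x. \<not> is_left x) xs) = set (map right_hole [1..<Suc n])"
    using assms by (simp_all only: lacing_sequence_iff permutations_of_set_def mem_Collect_eq
      set_map set_upt atLeastLessThanSuc_atLeastAtMost)
  have sorted: "sorted_wrt (\<lambda>p q. snd q < snd p) (map left_hole [1..<Suc n])"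
    "sorted_wrt (\<lambda>p q. snd q < snd p) (map right_hole [1..<Suc n])"
    by (simp_all add: sorted_wrt_map del: upt_Suc)
  have inj: "inj_on snd (set (map left_hole [1..<Suc n]))" "inj_on snd (set (map right_hole [1..<Suc n]))"
    by (auto simp: inj_on_def)
  show ?thesis
    unfolding descending_iff_filter[OF sub]
    using sorted_wrt_snd_unique[OF _ sorted(1) sets(1)] sorted_wrt_snd_unique[OF _ sorted(2) sets(2)]
      sorted inj unfolding sets by metis
qed

text \<open>Of two non-consecutive segments the later is \<open>below\<close> the earlier. For
  consecutive ones, the common hole has a neighbour in the opposite column, as
  \<open>adjacent_segments_meet\<close> requires.\<close>

lemma descending_no_self_intersection:
  assumes "lacing_sequence n xs" "descending xs"
  shows "no_self_intersection xs"
  unfolding no_self_intersection_def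
proof (intro allI impI)
  fix i j assume ij: "i < j \<and> j + 1 < length xs"
  have col: "in_columns (xs ! k)" if "k < length xs" for k
    using assms(1) that in_columns_holes nth_mem unfolding lacing_sequence_def by blast
  have down: "fst (xs ! k) = fst (xs ! l) \<longrightarrow> snd (xs ! l) < snd (xs ! k)" if "k < l" "l < length xs" for k l
    using assms(2) that unfolding descending_def by (simp add: sorted_wrt_iff_nth_less)
  have ne: "xs ! k \<noteq> xs ! l" if "k < l" "l < length xs" for k l
    using assms(1) that nth_eq_iff_index_eq[of xs k l] unfolding lacing_sequence_def by auto
  show "closed_segment (xs ! i) (xs ! (i + 1)) \<inter> closed_segment (xs ! j) (xs ! (j + 1)) =
      (if j = i + 1 then {xs ! j} else {})"
  proof (cases "j = i + 1")
    case True
    have "0 < j" "j + 1 < length xs" "j - 1 = i" using ij True by auto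
    then have "fst (xs ! i) \<noteq> fst (xs ! j) \<or> fst (xs ! (j + 1)) \<noteq> fst (xs ! j)"
      using assms(1) unfolding lacing_sequence_def by blast
    then have "closed_segment (xs ! i) (xs ! j) \<inter> closed_segment (xs ! j) (xs ! (j + 1)) = {xs ! j}"
      using ij by (intro adjacent_segments_meet col ne) auto
    then show ?thesis using True by simp
  next
    case False
    then have "below (xs ! i) (xs ! (i + 1)) (xs ! j) (xs ! (j + 1))"
      using ij down[of i j] down[of i "j + 1"] down[of "i + 1" j] down[of "i + 1" "j + 1"]
      by (simp add: below_def)
    then show ?thesis
      using below_disjoint col ij False by simp
  qed
qed

text \<open>Backward induction from the end of the lacing. The last hole is
  \<open>right_hole n\<close>, strictly lower than the end of the crossing segment in its column;
  each earlier segment after the crossing keeps both its ends on one side.\<close>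

lemma after_crossing_below:
  assumes lac: "lacing_sequence n xs" and last: "last xs = right_hole n"
    and nsi: "no_self_intersection xs"
    and k: "fst (xs ! k) \<noteq> fst (xs ! (k + 1))" and q: "k + 1 < q" "q < length xs"
  shows "side (xs ! k) (xs ! (k + 1)) (xs ! q) < 0"
proof -
  let ?s = "\<lambda>q. side (xs ! k) (xs ! (k + 1)) (xs ! q)"
  have hole: "xs ! i \<in> holes n" if "i < length xs" for i
    using lac that nth_mem unfolding lacing_sequence_def by blast
  note col = in_columns_holes[OF hole]
  have ne: "xs ! i \<noteq> xs ! j" if "i \<noteq> j" "i < length xs" "j < length xs" for i j
    using lac that nth_eq_iff_index_eq[of xs i j] unfolding lacing_sequence_def by auto
  have above_last: "snd (xs ! i) > snd (right_hole n)"
    if "i < length xs - 1" "fst (xs ! i) = 1" for i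
  proof -
    have "xs ! (length xs - 1) = right_hole n"
      using last that by (metis last_conv_nth list.size(3) less_zeroE diff_0_eq_0)
    then have "xs ! i \<noteq> right_hole n"
      using ne[of i "length xs - 1"] that by auto
    moreover have "xs ! i \<in> holes n"
      using that by (intro hole) simp
    ultimately show ?thesis
      using that by (auto elim!: holes_cases)
  qed
  have "q \<le> length xs - 1" using q by simp
  then show ?thesis
    using q(1)
  proof (induction q rule: inc_induct)
    case base
    have "xs ! (length xs - 1) = right_hole n"
      using last q by (metis last_conv_nth list.size(3) less_nat_zero_code)
    moreover have "fst (xs ! k) = 1 \<or> fst (xs ! (k + 1)) = 1"
      using col[of k] col[of "k + 1"] k q by (auto simp: in_columns_def)
    ultimately show ?case
      using above_last[of k] above_last[of "k + 1"] k base by (auto simp: side_first side_second)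
  next
    case (step m)
    \<comment> \<open>Here \<open>k + 1 < m\<close>, so the two segments are not consecutive and
      must be disjoint.\<close>
    have "closed_segment (xs ! k) (xs ! (k + 1)) \<inter> closed_segment (xs ! m) (xs ! (m + 1)) = {}"
      using nsi step unfolding no_self_intersection_def by auto
    then have "?s m * ?s (m + 1) > 0"
      using step k by (intro disjoint_segments_same_side col) auto
    moreover have "?s (m + 1) < 0"
      using step by simp
    ultimately show ?case by (simp add: zero_less_mult_iff)
  qed
qed

text \<open>An interior hole is an end of a crossing segment, and every later hole other than the
  ends of that segment lies below it. In the column of the chosen hole this is a comparison with the
  hole itself.\<close>

lemma no_self_intersection_descending:
  assumes lac: "lacing_sequence n xs" and hd: "hd xs = left_hole 1" and last: "last xs = right_hole n"
    and nsi: "no_self_intersection xs"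
  shows "descending xs"
  unfolding descending_def sorted_wrt_iff_nth_less
proof (intro allI impI)
  fix p q assume pq: "p < q" "q < length xs" "fst (xs ! p) = fst (xs ! q)"
  show "snd (xs ! q) < snd (xs ! p)"
  proof (cases "p = 0")
    case True
    then have p: "xs ! p = left_hole 1" using hd pq by (cases xs) auto
    have "xs ! q \<noteq> xs ! p"
      using lac pq nth_eq_iff_index_eq[of xs p q] unfolding lacing_sequence_def by auto
    moreover have "xs ! q \<in> holes n"
      using lac pq nth_mem unfolding lacing_sequence_def by blast
    ultimately show ?thesis
      using p pq(3) by (auto elim!: holes_cases)
  next
    case False
    then have "0 < p \<and> p + 1 < length xs" using pq by auto
    then consider "fst (xs ! (p - 1)) \<noteq> fst (xs ! p)" | "fst (xs ! (p + 1)) \<noteq> fst (xs ! p)"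
      using lac unfolding lacing_sequence_def by blast
    then show ?thesis
    proof cases
      case 1
      then have "side (xs ! (p - 1)) (xs ! (p - 1 + 1)) (xs ! q) < 0"
        using False pq by (intro after_crossing_below[OF lac last nsi]) auto
      then show ?thesis
        using False 1 pq(3) by (simp add: side_second)
    next
      case 2
      \<comment> \<open>The hole after \<open>p\<close> is the other end of the crossing segment,
        where the offset is 0; it lies in the opposite column and so is not the hole at
        \<open>q\<close>.\<close>
      have "q \<noteq> p + 1" using 2 pq(3) by auto
      then have "side (xs ! p) (xs ! (p + 1)) (xs ! q) < 0"
        using 2 pq by (intro after_crossing_below[OF lac last nsi]) auto
      then show ?thesis
        using pq(3) by (simp add: side_first)
    qed
  qed
qed

theorem theorem8:
  fixes n :: nat
  assumes "n \<ge> 1"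
  shows "card (non_self_crossing_lacings n) = a_count n n \<and>
         card (right_lacings n) = (fact (n - 1))\<^sup>2 * a_count n n"
proof
  have words: "card (words n n) = a_count n n"
    by (simp add: card_words a_count_eq_card_sparse_pairs card_sparse_pairs)
  have count: "count_list w True = n \<and> count_list w False = n" if "w \<in> words n n" for w
    using that by (simp add: words_def)
  have left: "length ls = n \<and> (\<forall>x\<in>set ls. is_left x)"
    if "ls \<in> permutations_of_set (left_hole ` {1..n})" for ls
    using that length_permutation_holes by (auto simp: permutations_of_set_def)
  have right: "length rs = n \<and> (\<forall>x\<in>set rs. \<not> is_left x)"
    if "rs \<in> permutations_of_set (right_hole ` {1..n})" for rs
    using that length_permutation_holes by (auto simp: permutations_of_set_def)
  show "card (right_lacings n) = (fact (n - 1))\<^sup>2 * a_count n n"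
  proof -
    let ?X = "{ls \<in> permutations_of_set (left_hole ` {1..n}). hd ls = left_hole 1}"
    let ?Y = "{rs \<in> permutations_of_set (right_hole ` {1..n}). last rs = right_hole 1}"
    have "card (right_lacings n) =
        card {xs. lacing_sequence n xs \<and> hd xs = left_hole 1 \<and> last xs = right_hole 1}"
      unfolding right_lacings_def
      by (rule card_lacings_with_ends[of _ "left_hole 1" "right_hole 1"]) auto
    \<comment> \<open>The word and the two column orders vary independently; each order has one end
      fixed.\<close>
    also have "\<dots> = card (words n n) * card ?X * card ?Y"
      unfolding lacing_with_ends_iff[OF assms]
      using left right by (intro card_interleavings[of _ n n] count) blast+
    also have "card ?X = fact (n - 1)"
      using assms by (subst card_permutations_with_hd) (auto simp: card_image inj_on_def)
    also have "card ?Y = fact (n - 1)"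
      using assms by (subst card_permutations_with_last) (auto simp: card_image inj_on_def)
    finally show ?thesis
      by (simp add: words power2_eq_square)
  qed
  show "card (non_self_crossing_lacings n) = a_count n n"
  proof -
    let ?L = "map left_hole [1..<Suc n]" and ?R = "map right_hole [1..<Suc n]"
    have LR: "?L \<in> permutations_of_set (left_hole ` {1..n})" "?R \<in> permutations_of_set (right_hole ` {1..n})"
      by (auto simp: permutations_of_set_def distinct_map inj_on_def atLeastLessThanSuc_atLeastAtMost simp del: upt_Suc)
    have "hd ?L = left_hole 1" "last ?R = right_hole n"
      using assms by (simp_all add: hd_map last_map del: upt_Suc)
    with LR have ends: "?L \<in> {ls \<in> permutations_of_set (left_hole ` {1..n}). hd ls = left_hole 1}"
      "?R \<in> {rs \<in> permutations_of_set (right_hole ` {1..n}). last rs = right_hole n}"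
      by blast+
    let ?Q = "\<lambda>xs. lacing_sequence n xs \<and> hd xs = left_hole 1 \<and> last xs = right_hole n"
    have "card (non_self_crossing_lacings n) =
        card {xs. lacing_sequence n xs \<and> hd xs = left_hole 1 \<and> last xs = right_hole n \<and> no_self_intersection xs}"
      unfolding non_self_crossing_lacings_def
      by (rule card_lacings_with_ends[of _ "left_hole 1" "right_hole n"]) auto
    \<comment> \<open>Absence of self-intersections is equivalent to \<open>descending\<close> here,
      so the two sets of column orders shrink to \<open>{?L}\<close> and \<open>{?R}\<close> while
      the words stay the same.\<close>
    also have "{xs. lacing_sequence n xs \<and> hd xs = left_hole 1 \<and> last xs = right_hole n \<and> no_self_intersection xs} =
        {xs. map is_left xs \<in> words n n \<and> filter is_left xs \<in> {?L} \<and> filter (\<lambda>x. \<not> is_left x) xs \<in> {?R}}"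
      (is "?A = ?B")
    proof (intro equalityI subsetI)
      fix xs assume xs: "xs \<in> ?A"
      then have "descending xs"
        using no_self_intersection_descending by blast
      then have "filter is_left xs = ?L \<and> filter (\<lambda>x. \<not> is_left x) xs = ?R"
        using xs descending_iff by blast
      moreover have "map is_left xs \<in> words n n"
        using xs lacing_with_ends_iff[OF assms, of xs n] by blast
      ultimately show "xs \<in> ?B" by blast
    next
      fix xs assume xs: "xs \<in> ?B"
      then have "?Q xs"
        using lacing_with_ends_iff[OF assms, of xs n] ends by auto
      moreover from this xs have "descending xs"
        using descending_iff by blast
      ultimately show "xs \<in> ?A"
        using descending_no_self_intersection by blast
    qed
    also have "card \<dots> = card (words n n) * card {?L} * card {?R}"
      using left[OF LR(1)] right[OF LR(2)] by (intro card_interleavings[of _ n n] count) blast+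
    finally show ?thesis
      by (simp add: words)
  qed
qed

end
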